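(* Let $m,N\ge1$ be integers and $\xi_1,\dots,\xi_m\in\mathbb{C}$ such that $1,\xi_1,\dots,\xi_m$ are linearly independent over $\overline{\mathbb{Q}}$. Let $\Omega=\{\kappa\in\mathbb{N}^m:\ N-1\le|\kappa|\le N\}$, $\Theta=\{\kappa\in\mathbb{N}^m:\ |\kappa|=N\}$, let $(E_\kappa)_{\kappa\in\Omega}$ be the canonical basis of $\mathbb{C}^\Omega$ and $(e_j)_{1\le j\le m}$ that of $\mathbb{Z}^m$. For $\kappa\in\Theta$ put $Z_\kappa=E_\kappa+\sum_{j=1}^m\xi_jE_{\kappa-e_j}$, with the convention $E_{\kappa-e_j}=0$ if $\kappa_j=0$, and let $F=\mathrm{Span}\{Z_\kappa:\ \kappa\in\Theta\}$. Then for every vector subspace $R$ of $\mathbb{C}^\Omega$ defined over $\overline{\mathbb{Q}}$, $$\dim R\ \ge\ \Big(2-\frac{m-1}{N+m-1}\Big)\dim(F\cap R),$$ and equality holds if and only if $R=\{0\}$ or $R=\mathbb{C}^\Omega$.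
   Context: $|\kappa|=\kappa_1+\dots+\kappa_m$. A subspace of $\mathbb{C}^\Omega$ is defined over $\overline{\mathbb{Q}}$ if it has a $\mathbb{C}$-basis consisting of vectors in $\overline{\mathbb{Q}}^\Omega$. *)

theory Defs
  imports Complex_Main "HOL-Library.Function_Algebras" "HOL-Computational_Algebra.Polynomial"
begin

text \<open>Multi-indices kappa in N^m are lists of naturals of length m (0-based coordinates).
  Vectors of C^Omega are functions nat list => complex vanishing outside Omega.\<close>

definition scf :: "complex \<Rightarrow> (nat list \<Rightarrow> complex) \<Rightarrow> (nat list \<Rightarrow> complex)" where
  "scf c f = (\<lambda>x. c * f x)"

definition Omega :: "nat \<Rightarrow> nat \<Rightarrow> nat list set" where
  "Omega m N = {k. length k = m \<and> N - 1 \<le> sum_list k \<and> sum_list k \<le> N}"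

definition Theta :: "nat \<Rightarrow> nat \<Rightarrow> nat list set" where
  "Theta m N = {k. length k = m \<and> sum_list k = N}"

definition CO :: "nat list set \<Rightarrow> (nat list \<Rightarrow> complex) set" where
  "CO Om = {f. \<forall>x. x \<notin> Om \<longrightarrow> f x = 0}"

definition E :: "nat list \<Rightarrow> (nat list \<Rightarrow> complex)" where
  "E k = (\<lambda>x. if x = k then 1 else 0)"

definition Z :: "nat \<Rightarrow> (nat \<Rightarrow> complex) \<Rightarrow> nat list \<Rightarrow> (nat list \<Rightarrow> complex)" where
  "Z m xi k = E k + (\<Sum>j<m. if k ! j = 0 then 0 else scf (xi j) (E (k[j := k ! j - 1])))"

definition F :: "nat \<Rightarrow> nat \<Rightarrow> (nat \<Rightarrow> complex) \<Rightarrow> (nat list \<Rightarrow> complex) set" where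
  "F m N xi = module.span scf (Z m xi ` Theta m N)"

definition defined_over_Qbar :: "(nat list \<Rightarrow> complex) set \<Rightarrow> bool" where
  "defined_over_Qbar R \<longleftrightarrow> (\<exists>B. (\<forall>b\<in>B. \<forall>x. algebraic (b x)) \<and>
      module.independent scf B \<and> module.span scf B = R)"

definition lin_indep_Qbar :: "nat \<Rightarrow> (nat \<Rightarrow> complex) \<Rightarrow> bool" where
  "lin_indep_Qbar m xi \<longleftrightarrow> (\<forall>(c0::complex) (c::nat \<Rightarrow> complex).
      algebraic c0 \<and> (\<forall>j<m. algebraic (c j)) \<and> c0 + (\<Sum>j<m. c j * xi j) = 0
        \<longrightarrow> c0 = 0 \<and> (\<forall>j<m. c j = 0))"

end

theory Submission
  imports Defs "HOL-Computational_Algebra.Fundamental_Theorem_Algebra"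
begin

text \<open>
  Write \<open>psi y r\<close> for the family \<open>r l - (\<Sum>j. y j * r (l + e j))\<close> indexed by \<open>|l| = N - 1\<close>, so that
  \<open>F = ker (psi xi)\<close>, and let \<open>w = dim (F \<inter> R)\<close>, \<open>b = dim (psi xi R)\<close>, \<open>dim R = w + b\<close>. By the
  Nullstellensatz \<open>xi\<close> specializes to algebraic points \<open>y\<close> with \<open>dim (psi y R) \<le> b\<close>, and these points
  can be taken outside any finite number of algebraic hyperplanes. Fix one such point \<open>z\<close>: the top
  degree parts of \<open>R \<inter> ker (psi z)\<close> form a space \<open>T\<close> with \<open>dim T \<ge> w\<close>, and the derivation along
  \<open>y - z\<close> maps \<open>T\<close> into \<open>psi y R\<close>, whence it has rank at most \<open>b\<close> on \<open>T\<close>.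

  In dual terms \<open>Q = T\<^sup>\<bottom>\<close> is a space of forms of degree \<open>N\<close> in \<open>m\<close> variables, and it has to be shown
  that for generic \<open>s\<close> the density of \<open>(Q : s)\<close> among the forms of degree \<open>N - 1\<close> is at most
  the density of \<open>Q\<close> among those of degree \<open>N\<close>, strictly unless the latter is \<open>0\<close> or \<open>1\<close>. Otherwise the
  restrictions of \<open>Q\<close> to the hyperplanes \<open>s = 0\<close> have at most the density of \<open>Q\<close>. Choose
  \<open>s\<^sub>0, \<dots>, s\<^sub>N\<close> one after the other, each generic relative to the preceding ones. Then \<open>dim Q\<close> is the
  sum over \<open>k\<close> of the dimensions of the restrictions to \<open>s\<^sub>k = 0\<close> of \<open>(Q : s\<^sub>k\<^sub>+\<^sub>1 \<cdots> s\<^sub>N)\<close>, whose densities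
  are bounded by that of \<open>Q\<close> by induction on the number of variables, one of them strictly; since the
  densities are taken in spaces whose dimensions add up to that of all forms of degree \<open>N\<close>,
  this gives \<open>dim Q < dim Q\<close>.
\<close>

section \<open>Finite-dimensional subspaces\<close>

text \<open>The ambient function types are infinite-dimensional, and \<open>dim\<close> is 0 on
  spaces without a finite basis, so every comparison of dimensions has to carry finiteness along
  explicitly.\<close>

definition fin_dim :: "('a::field \<Rightarrow> 'b::ab_group_add \<Rightarrow> 'b) \<Rightarrow> 'b set \<Rightarrow> bool" where
  "fin_dim s V \<longleftrightarrow> (\<exists>B. finite B \<and> V \<subseteq> module.span s B)"

context vector_space
begin

lemma fin_dim_span: "finite B \<Longrightarrow> fin_dim scale (span B)"
  unfolding fin_dim_def by blast

lemma fin_dim_subset: "V \<subseteq> W \<Longrightarrow> fin_dim scale W \<Longrightarrow> fin_dim scale V"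
  unfolding fin_dim_def by blast

lemma fin_dim_independent_finite:
  assumes "independent B" "B \<subseteq> V" "fin_dim scale V"
  shows "finite B"
  using assms independent_span_bound unfolding fin_dim_def by blast

lemma fin_dim_basis:
  assumes "subspace V" "fin_dim scale V"
  obtains B where "finite B" "B \<subseteq> V" "independent B" "span B = V" "card B = dim V"
proof -
  obtain B where B: "B \<subseteq> V" "independent B" "V \<subseteq> span B" "card B = dim V"
    using basis_exists by blast
  have "finite B" using fin_dim_independent_finite B assms by blast
  moreover have "span B = V" using B assms(1) by (simp add: span_minimal subset_antisym)
  ultimately show ?thesis using that B by blast
qed

lemma dim_mono_fin:
  assumes "V \<subseteq> W" "fin_dim scale W"
  shows "dim V \<le> dim W"
proof -
  have "fin_dim scale (span W)"
    using assms(2) unfolding fin_dim_def by (meson span_minimal subspace_span)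
  then obtain B where "finite B" "span B = span W" "card B = dim W"
    by (metis fin_dim_basis subspace_span dim_span)
  then show ?thesis
    by (metis assms(1) dim_le_card order_trans span_superset)
qed

text \<open>A vector of \<open>W\<close> outside \<open>V\<close> would extend a basis of
  \<open>V\<close> to an independent family in \<open>W\<close> with more than \<open>dim W\<close>
  elements.\<close>

lemma subspace_eq_if_dim_ge:
  assumes "subspace V" "subspace W" "V \<subseteq> W" "fin_dim scale W" "dim W \<le> dim V"
  shows "V = W"
proof -
  obtain B where B: "finite B" "B \<subseteq> V" "independent B" "span B = V" "card B = dim V"
    using fin_dim_basis assms fin_dim_subset by metis
  obtain C where C: "finite C" "C \<subseteq> W" "independent C" "span C = W" "card C = dim W"
    using fin_dim_basis assms by metis
  have "w \<in> V" if "w \<in> W" for w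
  proof (rule ccontr)
    assume "w \<notin> V"
    then have "independent (insert w B)" "w \<notin> B"
      using B independent_insertI by blast+
    moreover have "insert w B \<subseteq> span C" using that B C assms by auto
    ultimately have "card (insert w B) \<le> card C"
      using independent_span_bound C by blast
    then show False using \<open>w \<notin> B\<close> B C assms(5) by simp
  qed
  then show ?thesis using assms by blast
qed

lemma dim_zero_space: "dim {0} = 0"
  using dim_eq_card[of "{}" "{0}"] independent_empty by simp

lemma dim_eq_0_fin:
  assumes "subspace V" "fin_dim scale V" "dim V = 0"
  shows "V = {0}"
proof -
  have "{0} = V"
    by (rule subspace_eq_if_dim_ge) (use assms subspace_0 in auto)
  then show ?thesis by simp
qed

end

section \<open>Rank and nullity\<close>

context vector_space_pair
begin

lemma fin_dim_image:
  assumes "Vector_Spaces.linear s1 s2 f" "fin_dim s1 V"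
  shows "fin_dim s2 (f ` V)"
proof -
  obtain B where B: "finite B" "V \<subseteq> vs1.span B" using assms fin_dim_def by blast
  have "f ` V \<subseteq> vs2.span (f ` B)"
    using B linear_span_image[OF assms(1)] by blast
  then show ?thesis using B fin_dim_def by blast
qed

lemma linear_subspace_ker:
  assumes "Vector_Spaces.linear s1 s2 f" "vs1.subspace V"
  shows "vs1.subspace {x \<in> V. f x = 0}"
proof -
  interpret f: Vector_Spaces.linear s1 s2 f by (rule assms)
  show ?thesis
    using assms(2) unfolding vs1.subspace_def by (auto simp: f.add f.scale)
qed

text \<open>A basis \<open>B\<close> of the kernel and lifts \<open>g c\<close> of a basis
  \<open>C\<close> of the image together form a basis of \<open>V\<close>.\<close>

lemma rank_nullity:
  assumes lf: "Vector_Spaces.linear s1 s2 f" and V: "vs1.subspace V" "fin_dim s1 V"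
  shows "vs1.dim V = vs2.dim (f ` V) + vs1.dim {x \<in> V. f x = 0}"
proof -
  interpret f: Vector_Spaces.linear s1 s2 f by (rule lf)
  let ?K = "{x \<in> V. f x = 0}"
  have K: "vs1.subspace ?K" by (rule linear_subspace_ker[OF lf V(1)])
  obtain B where B: "finite B" "B \<subseteq> ?K" "vs1.independent B" "vs1.span B = ?K" "card B = vs1.dim ?K"
    using vs1.fin_dim_basis[OF K] vs1.fin_dim_subset[OF _ V(2), of ?K] by blast
  have I: "vs2.subspace (f ` V)" by (rule linear_subspace_image[OF lf V(1)])
  obtain C where C: "finite C" "C \<subseteq> f ` V" "vs2.independent C" "vs2.span C = f ` V"
      "card C = vs2.dim (f ` V)"
    using vs2.fin_dim_basis[OF I fin_dim_image[OF lf V(2)]] by blast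
  have "\<forall>c\<in>C. \<exists>x\<in>V. f x = c" using C(2) by blast
  then obtain g where g: "\<And>c. c \<in> C \<Longrightarrow> g c \<in> V \<and> f (g c) = c" by metis
  have inj: "inj_on g C" using g by (metis inj_onI)
  have C0: "0 \<notin> C" using C(3) vs2.dependent_zero by blast
  have disj: "B \<inter> g ` C = {}" using B(2) g C0 by auto
  have split: "(\<Sum>v\<in>B \<union> g ` C. s1 (u v) v) = (\<Sum>v\<in>B. s1 (u v) v) + (\<Sum>c\<in>C. s1 (u (g c)) (g c))" for u
    using disj B(1) C(1) inj by (simp add: sum.union_disjoint sum.reindex)
  have fsplit: "f (\<Sum>v\<in>B \<union> g ` C. s1 (u v) v) = (\<Sum>c\<in>C. s2 (u (g c)) c)" for u
  proof -
    have "f (\<Sum>v\<in>B. s1 (u v) v) = 0"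
      using B(2) by (auto simp: f.sum f.scale intro!: sum.neutral)
    moreover have "f (\<Sum>c\<in>C. s1 (u (g c)) (g c)) = (\<Sum>c\<in>C. s2 (u (g c)) c)"
      using g by (simp add: f.sum f.scale)
    ultimately show ?thesis by (simp add: split f.add)
  qed
  have ind: "vs1.independent (B \<union> g ` C)"
  proof (rule vs1.independent_if_scalars_zero)
    fix u v assume s: "(\<Sum>v\<in>B \<union> g ` C. s1 (u v) v) = 0" and v: "v \<in> B \<union> g ` C"
    \<comment> \<open>Applying \<open>f\<close> kills the part over \<open>B\<close>, so the
      coefficients of the lifts vanish first and those of the kernel basis afterwards.\<close>
    have "(\<Sum>c\<in>C. s2 (u (g c)) c) = 0" using fsplit[of u] s by simp
    then have uC: "u (g c) = 0" if "c \<in> C" for c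
      using vs2.independentD[OF C(3) C(1), of "\<lambda>c. u (g c)" c] that by simp
    then have "(\<Sum>v\<in>B. s1 (u v) v) = 0" using split[of u] s by simp
    then have "u v = 0" if "v \<in> B" for v
      using vs1.independentD[OF B(3) B(1), of u v] that by simp
    then show "u v = 0" using uC v by blast
  qed (use B C in auto)
  have "V \<subseteq> vs1.span (B \<union> g ` C)"
  proof
    fix x assume x: "x \<in> V"
    then have "f x \<in> vs2.span C" using C by blast
    then obtain u where u: "f x = (\<Sum>c\<in>C. s2 (u c) c)"
      using vs2.span_finite[OF C(1)] by auto
    let ?y = "\<Sum>c\<in>C. s1 (u c) (g c)"
    have "?y \<in> V" using g V(1) by (intro vs1.subspace_sum vs1.subspace_scale) auto
    moreover have "f ?y = f x" using g by (simp add: f.sum f.scale u)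
    ultimately have "x - ?y \<in> vs1.span B" using x V(1) B(4) by (simp add: f.diff vs1.subspace_diff)
    then have "x - ?y \<in> vs1.span (B \<union> g ` C)" by (meson in_mono sup_ge1 vs1.span_mono)
    moreover have "?y \<in> vs1.span (B \<union> g ` C)"
      by (intro vs1.span_sum vs1.span_scale vs1.span_base) auto
    ultimately show "x \<in> vs1.span (B \<union> g ` C)"
      using vs1.span_add by fastforce
  qed
  moreover have "B \<union> g ` C \<subseteq> V" using B(2) g by auto
  ultimately have "card (B \<union> g ` C) = vs1.dim V"
    using vs1.basis_card_eq_dim ind by blast
  moreover have "card (B \<union> g ` C) = card B + card C"
    using disj B(1) C(1) inj by (simp add: card_Un_disjoint card_image)
  ultimately show ?thesis using B C by simp
qed

lemma dim_image_inj_fin: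
  assumes "Vector_Spaces.linear s1 s2 f" "vs1.subspace V" "fin_dim s1 V" "\<And>x. x \<in> V \<Longrightarrow> f x = 0 \<Longrightarrow> x = 0"
  shows "vs2.dim (f ` V) = vs1.dim V"
proof -
  have "{x \<in> V. f x = 0} \<subseteq> {0}" using assms(4) by blast
  then have "vs1.dim {x \<in> V. f x = 0} = 0"
    using vs1.dim_mono_fin[of _ "{0}"] fin_dim_def vs1.dim_zero_space
    by (metis finite.emptyI le_zero_eq vs1.span_empty subset_refl)
  then show ?thesis using rank_nullity[OF assms(1-3)] by simp
qed

end

section \<open>The field of algebraic numbers\<close>

interpretation qv: vector_space "\<lambda>(q::rat) (x::complex). of_rat q * x"
  by unfold_locales (auto simp: algebra_simps of_rat_add of_rat_mult)

lemma rat_mult_linear: "Vector_Spaces.linear (\<lambda>(q::rat) (x::complex). of_rat q * x) (\<lambda>q x. of_rat q * x) ((*) z)"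
  by unfold_locales (auto simp: algebra_simps)

text \<open>The vectors \<open>z ^ k * m\<close> with \<open>k \<le> card B\<close> are too many to
  be independent over the rationals; a relation among them, divided by \<open>m\<close>, is a
  rational polynomial with root \<open>z\<close>.\<close>

lemma algebraic_if_stable_span:
  assumes B: "finite B" and m: "m \<in> qv.span B" "m \<noteq> 0"
    and stable: "\<And>x. x \<in> qv.span B \<Longrightarrow> z * x \<in> qv.span B"
  shows "algebraic z"
proof -
  have pow: "z ^ k * m \<in> qv.span B" for k
    by (induction k) (use m stable in \<open>auto simp: mult.assoc\<close>)
  let ?n = "card B" and ?f = "\<lambda>k. z ^ k * m"
  show ?thesis
  proof (cases "inj_on ?f {..?n}")
    case True
    then have "card (?f ` {..?n}) = Suc ?n" by (simp add: card_image)
    then have "qv.dependent (?f ` {..?n})"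
      using qv.independent_span_bound[OF B, of "?f ` {..?n}"] pow by fastforce
    then obtain u where u: "\<exists>v\<in>?f ` {..?n}. u v \<noteq> 0" "(\<Sum>v\<in>?f ` {..?n}. of_rat (u v) * v) = 0"
      using qv.dependent_finite[of "?f ` {..?n}"] by auto
    define p :: "complex poly" where "p = (\<Sum>k\<le>?n. monom (of_rat (u (?f k))) k)"
    have c: "coeff p k = (if k \<le> ?n then of_rat (u (?f k)) else 0)" for k
      unfolding p_def by (auto simp: coeff_sum if_distrib[of "\<lambda>f. coeff f k"] sum.delta)
    have "p \<noteq> 0" using u(1) c by (metis (no_types, lifting) atMost_iff coeff_0 imageE of_rat_eq_0_iff)
    moreover have "coeff p k \<in> \<rat>" for k using c by simp
    moreover have "poly p z * m = 0"
      using u(2) True by (simp add: p_def poly_sum poly_monom sum_distrib_right sum.reindex mult.assoc)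
    ultimately show ?thesis using m(2) algebraicI'[of p z] by simp
  next
    \<comment> \<open>Coinciding powers collapse in the image set, whose dependence then says
      nothing about them; here \<open>z\<close> is a root of a difference of two monomials
      instead.\<close>
    case False
    then obtain i j where ij: "z ^ i * m = z ^ j * m" "i \<noteq> j" unfolding inj_on_def by blast
    let ?p = "monom 1 i - monom 1 j :: complex poly"
    have "coeff ?p i = 1" using ij by simp
    then have "?p \<noteq> 0" by force
    moreover have "coeff ?p k \<in> \<rat>" for k by auto
    moreover have "poly ?p z = 0" using ij m(2) by (simp add: poly_monom)
    ultimately show ?thesis using algebraicI' by blast
  qed
qed

text \<open>Adjoining a root \<open>y\<close> of a monic polynomial: the new space is spanned by the
  products \<open>y ^ j * b\<close> with \<open>j < n\<close>. Multiplication by \<open>y\<close>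
  shifts \<open>j\<close>, the relation reduces \<open>y ^ n\<close>, and old multipliers survive
  because they commute with \<open>y ^ j\<close>.\<close>

lemma stable_span_adjoin:
  assumes B: "finite B" and n: "n \<ge> 1" and y: "y ^ n = (\<Sum>j<n. d j * y ^ j)"
    and d: "\<And>j x. j < n \<Longrightarrow> x \<in> qv.span B \<Longrightarrow> d j * x \<in> qv.span B"
  obtains B' where "finite B'" "qv.span B \<subseteq> qv.span B'"
    "\<And>x. x \<in> qv.span B' \<Longrightarrow> y * x \<in> qv.span B'"
    "\<And>a. \<forall>x\<in>qv.span B. a * x \<in> qv.span B \<Longrightarrow> \<forall>x\<in>qv.span B'. a * x \<in> qv.span B'"
proof -
  let ?B' = "(\<lambda>(j, b). y ^ j * b) ` ({..<n} \<times> B)"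
  have lin: "qv.span ((*) a ` S) = (*) a ` qv.span S" for a S
    using module_hom.span_image[OF rat_mult_linear[THEN Vector_Spaces.linear.axioms(3)]] .
  have pow: "y ^ j * x \<in> qv.span ?B'" if "j < n" "x \<in> qv.span B" for j x
  proof -
    have "y ^ j * x \<in> qv.span ((*) (y ^ j) ` B)" using lin that by blast
    moreover have "(*) (y ^ j) ` B \<subseteq> ?B'" using that by force
    ultimately show ?thesis using qv.span_mono by blast
  qed
  have ext: "a * x \<in> qv.span ?B'"
    if "\<And>j b. j < n \<Longrightarrow> b \<in> B \<Longrightarrow> a * (y ^ j * b) \<in> qv.span ?B'" "x \<in> qv.span ?B'" for a x
  proof -
    have "(*) a ` ?B' \<subseteq> qv.span ?B'" using that(1) by auto
    then have "qv.span ((*) a ` ?B') \<subseteq> qv.span ?B'" by (simp add: qv.span_minimal)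
    then show ?thesis using that(2) lin by blast
  qed
  show ?thesis
  proof
    show "finite ?B'" using B by simp
    show "qv.span B \<subseteq> qv.span ?B'" using pow[of 0] n by fastforce
    show "y * x \<in> qv.span ?B'" if "x \<in> qv.span ?B'" for x
    proof (rule ext[OF _ that])
      fix j b assume jb: "j < n" "b \<in> B"
      show "y * (y ^ j * b) \<in> qv.span ?B'"
      proof (cases "Suc j < n")
        case True
        then show ?thesis using pow[of "Suc j" b] jb qv.span_base by (simp add: mult.assoc)
      next
        case False
        then have "y * (y ^ j * b) = y ^ n * b" using jb
          by (metis Suc_lessI mult.assoc power_Suc)
        also have "\<dots> = (\<Sum>j<n. y ^ j * (d j * b))"
          unfolding y sum_distrib_right by (intro sum.cong) (simp_all add: mult_ac)
        also have "\<dots> \<in> qv.span ?B'"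
          by (intro qv.span_sum pow d) (use jb qv.span_base in auto)
        finally show ?thesis .
      qed
    qed
    show "\<forall>x\<in>qv.span ?B'. a * x \<in> qv.span ?B'"
      if "\<forall>x\<in>qv.span B. a * x \<in> qv.span B" for a
    proof (rule ballI, rule ext)
      fix j b assume jb: "j < n" "b \<in> B"
      show "a * (y ^ j * b) \<in> qv.span ?B'"
        using pow[of j "a * b"] that jb qv.span_base by (metis mult.left_commute)
    qed simp
  qed
qed

lemma poly_root_power:
  fixes p :: "complex poly"
  assumes "poly p y = 0" "p \<noteq> 0"
  shows "degree p \<ge> 1" "y ^ degree p = (\<Sum>j<degree p. - (coeff p j / lead_coeff p) * y ^ j)"
proof -
  show "degree p \<ge> 1"
  proof (rule ccontr)
    assume "\<not> degree p \<ge> 1"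
    then obtain c where "p = [:c:]" by (metis degree_eq_zeroE less_one not_le)
    then show False using assms by simp
  qed
  have "0 = lead_coeff p * y ^ degree p + (\<Sum>j<degree p. coeff p j * y ^ j)"
    using assms(1) by (simp add: poly_altdef lessThan_Suc_atMost[symmetric] add.commute)
  then have "lead_coeff p * y ^ degree p = - (\<Sum>j<degree p. coeff p j * y ^ j)"
    by (simp add: eq_neg_iff_add_eq_0)
  then have "y ^ degree p = - (\<Sum>j<degree p. coeff p j * y ^ j) / lead_coeff p"
    using assms(2) by (simp add: field_simps)
  then show "y ^ degree p = (\<Sum>j<degree p. - (coeff p j / lead_coeff p) * y ^ j)"
    by (simp add: sum_divide_distrib sum_negf)
qed

text \<open>The elements of \<open>S\<close> are adjoined one by one to the rational line through
  \<open>1\<close>; the vector \<open>1\<close> later serves as the nonzero vector in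
  \<open>algebraic_if_stable_span\<close>.\<close>

lemma stable_span_exists:
  assumes "finite S" "\<And>a. a \<in> S \<Longrightarrow> algebraic a"
  shows "\<exists>B. finite B \<and> 1 \<in> qv.span B \<and> (\<forall>a\<in>S. \<forall>x\<in>qv.span B. a * x \<in> qv.span B)"
  using assms
proof (induction S rule: finite_induct)
  case empty
  show ?case by (rule exI[of _ "{1}"]) (simp add: qv.span_base)
next
  case (insert a S)
  then obtain B where B: "finite B" "1 \<in> qv.span B" "\<forall>a\<in>S. \<forall>x\<in>qv.span B. a * x \<in> qv.span B"
    by blast
  obtain p where p: "\<And>i. coeff p i \<in> \<rat>" "p \<noteq> 0" "poly p a = 0"
    using insert.prems[of a] unfolding algebraic_altdef by auto
  have d: "- (coeff p j / lead_coeff p) * x \<in> qv.span B" if "x \<in> qv.span B" for j x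
  proof -
    have "- (coeff p j / lead_coeff p) \<in> \<rat>" using p(1) by simp
    then obtain q where "- (coeff p j / lead_coeff p) = of_rat q" by (rule Rats_cases)
    then show ?thesis using qv.span_scale[OF that, of q] by simp
  qed
  obtain B' where B': "finite B'" "qv.span B \<subseteq> qv.span B'"
    "\<And>x. x \<in> qv.span B' \<Longrightarrow> a * x \<in> qv.span B'"
    "\<And>c. \<forall>x\<in>qv.span B. c * x \<in> qv.span B \<Longrightarrow> \<forall>x\<in>qv.span B'. c * x \<in> qv.span B'"
    by (rule stable_span_adjoin[OF B(1) poly_root_power[OF p(3,2)] d]) blast+
  have "\<forall>c\<in>insert a S. \<forall>x\<in>qv.span B'. c * x \<in> qv.span B'"
    using B'(3,4) B(3) by blast
  then show ?case using B' B(2) by blast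
qed

text \<open>If \<open>a\<close> and \<open>b\<close> are multipliers of one finite-dimensional
  rational space, so are their sum and product.\<close>

lemma algebraic_add_mult:
  assumes "algebraic (a::complex)" "algebraic b"
  shows "algebraic (a + b)" "algebraic (a * b)"
proof -
  obtain B where B: "finite B" "1 \<in> qv.span B" "\<forall>c\<in>{a,b}. \<forall>x\<in>qv.span B. c * x \<in> qv.span B"
    using stable_span_exists[of "{a,b}"] assms by blast
  then have s: "x \<in> qv.span B \<Longrightarrow> a * x \<in> qv.span B" "x \<in> qv.span B \<Longrightarrow> b * x \<in> qv.span B" for x
    by auto
  show "algebraic (a + b)"
    by (rule algebraic_if_stable_span[OF B(1,2)]) (auto simp: distrib_right s qv.span_add)
  show "algebraic (a * b)"
    by (rule algebraic_if_stable_span[OF B(1,2)]) (auto simp: mult.assoc s)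
qed

lemma algebraic_of_rat: "x \<in> \<rat> \<Longrightarrow> algebraic (x::complex)"
  by (rule algebraicI'[of "[:-x, 1:]"]) (auto simp: coeff_pCons split: nat.splits)

lemma algebraic_uminus: "algebraic (a::complex) \<Longrightarrow> algebraic (- a)"
  using algebraic_add_mult(2)[of "-1" a] algebraic_of_rat[of "-1"] by simp

lemma algebraic_diff: "algebraic (a::complex) \<Longrightarrow> algebraic b \<Longrightarrow> algebraic (a - b)"
  using algebraic_add_mult(1)[of a "- b"] algebraic_uminus by simp

lemma algebraic_inverse:
  assumes "algebraic (a::complex)"
  shows "algebraic (inverse a)"
proof (cases "a = 0")
  case False
  obtain p where p: "\<And>i. coeff p i \<in> \<int>" "p \<noteq> 0" "poly p a = 0"
    using assms by (erule algebraicE)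
  have "poly (reflect_poly p) (inverse a) = 0"
    using False p(3) by (simp add: poly_reflect_poly_nz)
  moreover have "coeff (reflect_poly p) i \<in> \<int>" for i
    using p(1) by (simp add: coeff_reflect_poly)
  moreover have "reflect_poly p \<noteq> 0" using p(2) by simp
  ultimately show ?thesis using algebraicI by blast
qed (simp add: assms)

lemma algebraic_divide: "algebraic (a::complex) \<Longrightarrow> algebraic b \<Longrightarrow> algebraic (a / b)"
  by (simp add: divide_inverse algebraic_add_mult algebraic_inverse)

lemma algebraic_sum: "(\<And>i. i \<in> I \<Longrightarrow> algebraic (f i :: complex)) \<Longrightarrow> algebraic (sum f I)"
  by (induction I rule: infinite_finite_induct) (simp_all add: algebraic_add_mult(1) algebraic_of_rat)

text \<open>A rational space stable under the normalized coefficients can be enlarged to one stable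
  under \<open>y\<close>. This is the algebraic closedness of the field of algebraic
  numbers.\<close>

lemma algebraic_poly_root:
  assumes "\<And>i. algebraic (coeff p i)" "p \<noteq> 0" "poly p (y::complex) = 0"
  shows "algebraic y"
proof -
  let ?d = "\<lambda>j. - (coeff p j / lead_coeff p)"
  have "algebraic a" if "a \<in> ?d ` {..<degree p}" for a
    using that assms(1) by (auto intro!: algebraic_uminus algebraic_divide)
  then obtain B where B: "finite B" "1 \<in> qv.span B"
      "\<forall>c\<in>?d ` {..<degree p}. \<forall>x\<in>qv.span B. c * x \<in> qv.span B"
    using stable_span_exists[of "?d ` {..<degree p}"] by auto
  have d: "?d j * x \<in> qv.span B" if "j < degree p" "x \<in> qv.span B" for j x
    using B(3) that by (meson imageI lessThan_iff)
  obtain B' where B': "finite B'" "qv.span B \<subseteq> qv.span B'"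
    "\<And>x. x \<in> qv.span B' \<Longrightarrow> y * x \<in> qv.span B'"
    by (rule stable_span_adjoin[OF B(1) poly_root_power[OF assms(3,2)] d]) blast+
  show ?thesis
    by (rule algebraic_if_stable_span[OF B'(1), of 1]) (use B' B(2) in auto)
qed

section \<open>Specializations of finitely generated algebras\<close>

definition over :: "complex set \<Rightarrow> complex poly \<Rightarrow> bool" where
  "over A p \<longleftrightarrow> (\<forall>i. coeff p i \<in> A)"

definition Qbar_algebra :: "complex set \<Rightarrow> bool" where
  "Qbar_algebra A \<longleftrightarrow> (\<forall>k. algebraic k \<longrightarrow> k \<in> A) \<and> (\<forall>a\<in>A. \<forall>b\<in>A. a + b \<in> A \<and> a * b \<in> A)"

text \<open>For finitely generated \<open>A\<close> these are the points with algebraic coordinates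
  of the affine variety with coordinate ring \<open>A\<close>. The functions are total, but only
  their values on \<open>A\<close> matter.\<close>

definition Qbar_hom :: "complex set \<Rightarrow> (complex \<Rightarrow> complex) \<Rightarrow> bool" where
  "Qbar_hom A \<phi> \<longleftrightarrow> (\<forall>k. algebraic k \<longrightarrow> \<phi> k = k) \<and> (\<forall>a\<in>A. algebraic (\<phi> a)) \<and>
     (\<forall>a\<in>A. \<forall>b\<in>A. \<phi> (a + b) = \<phi> a + \<phi> b \<and> \<phi> (a * b) = \<phi> a * \<phi> b)"

definition adjoin :: "complex set \<Rightarrow> complex \<Rightarrow> complex set" where
  "adjoin A x = {poly p x | p. over A p}"

section \<open>Polynomials over an algebra of complex numbers\<close>

context
  fixes A :: "complex set"
  assumes A: "Qbar_algebra A"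
begin

lemma Qbar_algebra_algebraic: "algebraic k \<Longrightarrow> k \<in> A"
  and Qbar_algebra_add: "a \<in> A \<Longrightarrow> b \<in> A \<Longrightarrow> a + b \<in> A"
  and Qbar_algebra_mult: "a \<in> A \<Longrightarrow> b \<in> A \<Longrightarrow> a * b \<in> A"
  using A unfolding Qbar_algebra_def by auto

lemma Qbar_algebra_0: "0 \<in> A" and Qbar_algebra_1: "1 \<in> A"
  by (auto intro: Qbar_algebra_algebraic algebraic_of_rat)

lemma Qbar_algebra_uminus: "a \<in> A \<Longrightarrow> - a \<in> A"
  using Qbar_algebra_mult[of "-1" a] Qbar_algebra_algebraic[of "-1"] algebraic_of_rat[of "-1"] by simp

lemma Qbar_algebra_diff: "a \<in> A \<Longrightarrow> b \<in> A \<Longrightarrow> a - b \<in> A"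
  using Qbar_algebra_add[of a "- b"] Qbar_algebra_uminus by simp

lemma Qbar_algebra_sum: "(\<And>i. i \<in> I \<Longrightarrow> f i \<in> A) \<Longrightarrow> sum f I \<in> A"
  by (induction I rule: infinite_finite_induct) (auto simp: Qbar_algebra_0 Qbar_algebra_add)

lemma Qbar_algebra_prod: "(\<And>i. i \<in> I \<Longrightarrow> f i \<in> A) \<Longrightarrow> prod f I \<in> A"
  by (induction I rule: infinite_finite_induct) (auto simp: Qbar_algebra_1 Qbar_algebra_mult)

lemma Qbar_algebra_power: "a \<in> A \<Longrightarrow> a ^ n \<in> A"
  by (induction n) (auto simp: Qbar_algebra_1 Qbar_algebra_mult)

lemma over_add: "over A p \<Longrightarrow> over A q \<Longrightarrow> over A (p + q)"
  and over_diff: "over A p \<Longrightarrow> over A q \<Longrightarrow> over A (p - q)"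
  and over_mult: "over A p \<Longrightarrow> over A q \<Longrightarrow> over A (p * q)"
  and over_smult: "a \<in> A \<Longrightarrow> over A p \<Longrightarrow> over A (smult a p)"
  and over_monom: "a \<in> A \<Longrightarrow> over A (monom a n)"
  unfolding over_def
  by (auto simp: Qbar_algebra_add Qbar_algebra_diff coeff_mult Qbar_algebra_mult Qbar_algebra_0
      intro!: Qbar_algebra_sum)

lemma over_pCons: "a \<in> A \<Longrightarrow> over A p \<Longrightarrow> over A (pCons a p)"
  unfolding over_def by (auto simp: coeff_pCons split: nat.splits)

lemma over_0: "over A 0"
  unfolding over_def by (simp add: Qbar_algebra_0)

text \<open>The leading coefficient of \<open>d\<close> need not be invertible in \<open>A\<close>;
  each division step is made possible by multiplying with it once more.\<close>

lemma pseudo_division_over: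
  assumes "over A p" "over A d" "d \<noteq> 0"
  shows "\<exists>k q r. over A q \<and> over A r \<and> smult (lead_coeff d ^ k) p = q * d + r \<and> (r = 0 \<or> degree r < degree d)"
  using assms(1)
\<comment> \<open>The measure separates the zero polynomial from the nonzero constants, which have
  degree 0 as well, so that it also drops when \<open>p'\<close> becomes 0.\<close>
proof (induction "if p = 0 then 0 else Suc (degree p)" arbitrary: p rule: less_induct)
  case less
  show ?case
  proof (cases "p = 0 \<or> degree p < degree d")
    case True
    show ?thesis
      by (rule exI[of _ 0], rule exI[of _ 0], rule exI[of _ p]) (use True less.prems over_0 in auto)
  next
    case False
    define m where "m = monom (lead_coeff p) (degree p - degree d)"
    define p' where "p' = smult (lead_coeff d) p - m * d"
    have m: "over A m" unfolding m_def using less.prems by (intro over_monom) (simp add: over_def)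
    have ld: "lead_coeff d \<in> A" using assms(2) by (simp add: over_def)
    have p'A: "over A p'"
      unfolding p'_def using less.prems assms(2) m ld by (intro over_diff over_mult over_smult)
    have "degree (m * d) \<le> degree p"
      using False degree_mult_le[of m d] degree_monom_le[of "lead_coeff p" "degree p - degree d"]
      unfolding m_def by linarith
    then have le: "degree p' \<le> degree p"
      unfolding p'_def by (intro degree_diff_le) auto
    have "coeff (m * d) (degree p) = lead_coeff p * lead_coeff d"
      using False unfolding m_def by (simp add: coeff_monom_mult)
    then have "coeff p' (degree p) = 0" unfolding p'_def by simp
    then have "p' = 0 \<or> degree p' < degree p"
      using le by (metis le_neq_implies_less leading_coeff_0_iff)
    then have "(if p' = 0 then 0 else Suc (degree p')) < (if p = 0 then 0 else Suc (degree p))"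
      using False by auto
    from less.hyps[OF this p'A] obtain k q r where
      kqr: "over A q" "over A r" "smult (lead_coeff d ^ k) p' = q * d + r" "r = 0 \<or> degree r < degree d"
      by blast
    have "smult (lead_coeff d ^ Suc k) p = smult (lead_coeff d ^ k) p' + smult (lead_coeff d ^ k) m * d"
      unfolding p'_def by (simp add: smult_diff_right mult.commute)
    also have "\<dots> = (q + smult (lead_coeff d ^ k) m) * d + r"
      using kqr(3) by (simp add: algebra_simps)
    finally have eq: "smult (lead_coeff d ^ Suc k) p = (q + smult (lead_coeff d ^ k) m) * d + r" .
    have "over A (q + smult (lead_coeff d ^ k) m)"
      using kqr(1) m ld by (intro over_add over_smult Qbar_algebra_power)
    then show ?thesis using eq kqr by blast
  qed
qed

lemma Qbar_algebra_adjoin: "Qbar_algebra (adjoin A x)"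
  unfolding Qbar_algebra_def
proof (intro conjI ballI allI impI)
  fix k :: complex assume "algebraic k"
  then have "over A [:k:]" using over_pCons[OF Qbar_algebra_algebraic over_0] by blast
  then show "k \<in> adjoin A x" unfolding adjoin_def by (force intro: exI[of _ "[:k:]"])
next
  fix a b assume "a \<in> adjoin A x" "b \<in> adjoin A x"
  then obtain p q where pq: "over A p" "over A q" "a = poly p x" "b = poly q x"
    unfolding adjoin_def by auto
  show "a + b \<in> adjoin A x" "a * b \<in> adjoin A x"
    unfolding adjoin_def mem_Collect_eq
    using over_add[OF pq(1,2)] over_mult[OF pq(1,2)] pq(3,4) by (metis poly_add, metis poly_mult)
qed

lemma subset_adjoin: "A \<subseteq> adjoin A x"
proof
  fix a assume "a \<in> A"
  then have "over A [:a:]" using over_pCons over_0 by blast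
  then show "a \<in> adjoin A x" unfolding adjoin_def by (force intro: exI[of _ "[:a:]"])
qed

lemma mem_adjoin: "x \<in> adjoin A x"
proof -
  have "over A [:0, 1:]" using over_pCons over_0 Qbar_algebra_0 Qbar_algebra_1 by blast
  then show ?thesis unfolding adjoin_def by (force intro: exI[of _ "[:0, 1:]"])
qed

section \<open>Homomorphisms to the algebraic numbers and their extension\<close>

context
  fixes \<phi> :: "complex \<Rightarrow> complex"
  assumes \<phi>: "Qbar_hom A \<phi>"
begin

lemma Qbar_hom_algebraic: "algebraic k \<Longrightarrow> \<phi> k = k"
  and Qbar_hom_range: "a \<in> A \<Longrightarrow> algebraic (\<phi> a)"
  and Qbar_hom_add: "a \<in> A \<Longrightarrow> b \<in> A \<Longrightarrow> \<phi> (a + b) = \<phi> a + \<phi> b"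
  and Qbar_hom_mult: "a \<in> A \<Longrightarrow> b \<in> A \<Longrightarrow> \<phi> (a * b) = \<phi> a * \<phi> b"
  using \<phi> unfolding Qbar_hom_def by auto

lemma Qbar_hom_0: "\<phi> 0 = 0" and Qbar_hom_1: "\<phi> 1 = 1"
  by (auto intro!: Qbar_hom_algebraic algebraic_of_rat)

lemma Qbar_hom_diff: "a \<in> A \<Longrightarrow> b \<in> A \<Longrightarrow> \<phi> (a - b) = \<phi> a - \<phi> b"
  using Qbar_hom_add[of "a - b" b] Qbar_algebra_diff[of a b] by simp

lemma Qbar_hom_sum: "(\<And>i. i \<in> I \<Longrightarrow> f i \<in> A) \<Longrightarrow> \<phi> (sum f I) = (\<Sum>i\<in>I. \<phi> (f i))"
  by (induction I rule: infinite_finite_induct)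
     (auto simp: Qbar_hom_0 Qbar_hom_add Qbar_algebra_sum)

lemma Qbar_hom_prod: "(\<And>i. i \<in> I \<Longrightarrow> f i \<in> A) \<Longrightarrow> \<phi> (prod f I) = (\<Prod>i\<in>I. \<phi> (f i))"
  by (induction I rule: infinite_finite_induct)
     (auto simp: Qbar_hom_1 Qbar_hom_mult Qbar_algebra_prod)

lemma Qbar_hom_power: "a \<in> A \<Longrightarrow> \<phi> (a ^ n) = \<phi> a ^ n"
  by (induction n) (auto simp: Qbar_hom_1 Qbar_hom_mult Qbar_algebra_power)

lemma coeff_map_hom: "coeff (map_poly \<phi> p) i = \<phi> (coeff p i)"
  by (simp add: coeff_map_poly Qbar_hom_0)

lemma map_hom_add: "over A p \<Longrightarrow> over A q \<Longrightarrow> map_poly \<phi> (p + q) = map_poly \<phi> p + map_poly \<phi> q"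
  by (rule poly_eqI) (auto simp: coeff_map_hom Qbar_hom_add over_def)

lemma map_hom_diff: "over A p \<Longrightarrow> over A q \<Longrightarrow> map_poly \<phi> (p - q) = map_poly \<phi> p - map_poly \<phi> q"
  by (rule poly_eqI) (auto simp: coeff_map_hom Qbar_hom_diff over_def)

lemma map_hom_mult: "over A p \<Longrightarrow> over A q \<Longrightarrow> map_poly \<phi> (p * q) = map_poly \<phi> p * map_poly \<phi> q"
  by (rule poly_eqI) (auto simp: coeff_map_hom coeff_mult Qbar_hom_sum Qbar_hom_mult Qbar_algebra_mult over_def)

lemma map_hom_smult: "a \<in> A \<Longrightarrow> over A p \<Longrightarrow> map_poly \<phi> (smult a p) = smult (\<phi> a) (map_poly \<phi> p)"
  by (rule poly_eqI) (auto simp: coeff_map_hom Qbar_hom_mult over_def)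

lemma map_hom_const: "map_poly \<phi> [:a:] = [:\<phi> a:]"
  by (rule poly_eqI) (auto simp: coeff_map_hom coeff_pCons Qbar_hom_0 split: nat.splits)

lemma Qbar_hom_extend:
  assumes \<alpha>: "algebraic \<alpha>" and rel: "\<And>p. over A p \<Longrightarrow> poly p x = 0 \<Longrightarrow> poly (map_poly \<phi> p) \<alpha> = 0"
  obtains \<psi> where "Qbar_hom (adjoin A x) \<psi>" "\<And>p. over A p \<Longrightarrow> \<psi> (poly p x) = poly (map_poly \<phi> p) \<alpha>"
proof -
  \<comment> \<open>An element of \<open>adjoin A x\<close> may be the value of several polynomials;
    one is chosen, and \<open>rel\<close> makes the result independent of the choice.\<close>
  define \<psi> where "\<psi> z = poly (map_poly \<phi> (SOME p. over A p \<and> poly p x = z)) \<alpha>" for z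
  have eq: "\<psi> (poly p x) = poly (map_poly \<phi> p) \<alpha>" if p: "over A p" for p
  proof -
    let ?q = "SOME q. over A q \<and> poly q x = poly p x"
    have q: "over A ?q \<and> poly ?q x = poly p x" by (rule someI[of _ p]) (simp add: p)
    then have "poly (map_poly \<phi> (?q - p)) \<alpha> = 0" using p by (intro rel over_diff) auto
    then show ?thesis using q p unfolding \<psi>_def by (simp add: map_hom_diff)
  qed
  have "Qbar_hom (adjoin A x) \<psi>"
    unfolding Qbar_hom_def
  proof (intro conjI ballI allI impI)
    fix k :: complex assume k: "algebraic k"
    then have "over A [:k:]" using over_pCons[OF Qbar_algebra_algebraic over_0] by blast
    from eq[OF this] show "\<psi> k = k" using k by (simp add: map_hom_const Qbar_hom_algebraic)
  next
    fix a assume "a \<in> adjoin A x"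
    then obtain p where p: "over A p" "a = poly p x" unfolding adjoin_def by auto
    have "algebraic (\<alpha> ^ i)" for i
      by (induction i) (auto simp: algebraic_of_rat algebraic_add_mult(2) \<alpha>)
    then have "algebraic (poly (map_poly \<phi> p) \<alpha>)"
      using p(1) unfolding poly_altdef
      by (intro algebraic_sum algebraic_add_mult(2)) (auto simp: coeff_map_hom Qbar_hom_range over_def)
    then show "algebraic (\<psi> a)" using p eq by simp
  next
    fix a b assume "a \<in> adjoin A x" "b \<in> adjoin A x"
    then obtain p q where pq: "over A p" "over A q" "a = poly p x" "b = poly q x"
      unfolding adjoin_def by auto
    show "\<psi> (a + b) = \<psi> a + \<psi> b"
      using eq[OF over_add[OF pq(1,2)]] pq by (simp add: eq map_hom_add)
    show "\<psi> (a * b) = \<psi> a * \<psi> b"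
      using eq[OF over_mult[OF pq(1,2)]] pq by (simp add: eq map_hom_mult)
  qed
  then show ?thesis using that eq by blast
qed

end

text \<open>The induction step of the Nullstellensatz: a homomorphism extends to \<open>A[x]\<close> without killing
  a given \<open>v\<close>, as soon as it does not kill a suitable \<open>u \<in> A\<close> depending only on \<open>x\<close> and \<open>v\<close>.\<close>

lemma Qbar_hom_extend_nonzero:
  assumes v: "v \<in> adjoin A x" "v \<noteq> 0"
  obtains u where "u \<in> A" "u \<noteq> 0"
    "\<And>\<phi>. Qbar_hom A \<phi> \<Longrightarrow> \<phi> u \<noteq> 0 \<Longrightarrow> \<exists>\<psi>. Qbar_hom (adjoin A x) \<psi> \<and> \<psi> v \<noteq> 0"
proof -
  obtain g where g: "over A g" "v = poly g x" using v(1) unfolding adjoin_def by auto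
  have "g \<noteq> 0" using v g by auto
  show ?thesis
  proof (cases "\<exists>p. over A p \<and> p \<noteq> 0 \<and> poly p x = 0")
    case False
    \<comment> \<open>Here \<open>x\<close> is transcendental over \<open>A\<close> and may be sent
      to any algebraic number that is not a root of the image of \<open>g\<close>. That image is
      nonzero if the leading coefficient of \<open>g\<close> survives, and the natural numbers
      supply infinitely many candidates.\<close>
    show ?thesis
    proof (rule that[of "lead_coeff g"])
      fix \<phi> assume \<phi>: "Qbar_hom A \<phi>" and "\<phi> (lead_coeff g) \<noteq> 0"
      then have "map_poly \<phi> g \<noteq> 0" by (metis coeff_0 coeff_map_hom)
      then have "finite {z. poly (map_poly \<phi> g) z = 0}" by (rule poly_roots_finite)
      moreover have "infinite (range (of_nat :: nat \<Rightarrow> complex))"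
        by (simp add: inj_of_nat range_inj_infinite)
      ultimately obtain \<alpha> where \<alpha>: "\<alpha> \<in> range of_nat" "poly (map_poly \<phi> g) \<alpha> \<noteq> 0"
        by (metis (mono_tags, lifting) mem_Collect_eq finite_subset subsetI)
      obtain \<psi> where "Qbar_hom (adjoin A x) \<psi>" "\<And>p. over A p \<Longrightarrow> \<psi> (poly p x) = poly (map_poly \<phi> p) \<alpha>"
      proof (rule Qbar_hom_extend[OF \<phi>])
        show "algebraic \<alpha>" using \<alpha>(1) by (auto intro: algebraic_of_rat)
        show "poly (map_poly \<phi> p) \<alpha> = 0" if "over A p" "poly p x = 0" for p
          using False that by (metis map_poly_0 poly_0)
      qed blast
      then show "\<exists>\<psi>. Qbar_hom (adjoin A x) \<psi> \<and> \<psi> v \<noteq> 0" using g \<alpha>(2) by metis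
    qed (use g \<open>g \<noteq> 0\<close> in \<open>auto simp: over_def\<close>)
  next
    case True
    let ?P = "\<lambda>p. over A p \<and> p \<noteq> 0 \<and> poly p x = 0"
    \<comment> \<open>\<open>p\<close> plays the role of the minimal polynomial of \<open>x\<close>
      over the fraction field of \<open>A\<close>; it divides every relation up to a power of its
      leading coefficient.\<close>
    define p where "p = arg_min degree ?P"
    have p: "?P p" and pmin: "\<And>q. ?P q \<Longrightarrow> degree p \<le> degree q"
      using True arg_min_natI[of ?P _ degree] arg_min_nat_le[of ?P _ degree] unfolding p_def by blast+
    have divp: "\<exists>k q. over A q \<and> smult (lead_coeff p ^ k) f = q * p" if f: "over A f" "poly f x = 0" for f
    proof -
      obtain k q r where kqr: "over A q" "over A r" "smult (lead_coeff p ^ k) f = q * p + r"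
          "r = 0 \<or> degree r < degree p"
        using pseudo_division_over[OF f(1), of p] p by blast
      have "poly (smult (lead_coeff p ^ k) f) x = poly (q * p + r) x" using kqr(3) by simp
      then have "poly r x = 0" using f p by simp
      then have "r = 0" using pmin[of r] kqr by fastforce
      then show ?thesis using kqr by auto
    qed
    \<comment> \<open>A combination of \<open>p\<close> and \<open>g\<close> of least degree is
      their greatest common divisor up to powers of its leading coefficient. It turns out to be a
      nonzero constant \<open>c\<close>, giving a Bezout relation
      \<open>c = s * p + t * g\<close>.\<close>
    let ?Q = "\<lambda>r. r \<noteq> 0 \<and> (\<exists>s t. over A s \<and> over A t \<and> r = s * p + t * g)"
    define r where "r = arg_min degree ?Q"
    have oneA: "over A 1" using over_pCons[OF Qbar_algebra_1 over_0] by (simp add: one_pCons)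
    have Qg: "?Q g" using \<open>g \<noteq> 0\<close> over_0 oneA by force
    have r: "?Q r" and rmin: "\<And>q. ?Q q \<Longrightarrow> degree r \<le> degree q"
      using Qg arg_min_natI[of ?Q _ degree] arg_min_nat_le[of ?Q _ degree] unfolding r_def by blast+
    obtain s t where st: "over A s" "over A t" "r = s * p + t * g" using r by blast
    have rA: "over A r" using st p g by (auto intro!: over_add over_mult)
    have divr: "\<exists>k q. over A q \<and> smult (lead_coeff r ^ k) f = q * r"
      if f: "over A f" "\<exists>s t. over A s \<and> over A t \<and> f = s * p + t * g" for f
    proof -
      obtain k q r' where kqr: "over A q" "over A r'" "smult (lead_coeff r ^ k) f = q * r + r'"
          "r' = 0 \<or> degree r' < degree r"
        using pseudo_division_over[OF f(1) rA] r by blast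
      obtain s' t' where st': "over A s'" "over A t'" "f = s' * p + t' * g" using f by blast
      have lc: "lead_coeff r ^ k \<in> A" using rA Qbar_algebra_power by (auto simp: over_def)
      have "r' = smult (lead_coeff r ^ k) f - q * r" using kqr(3) by simp
      also have "\<dots> = (smult (lead_coeff r ^ k) s' - q * s) * p + (smult (lead_coeff r ^ k) t' - q * t) * g"
        unfolding st(3) st'(3) by (simp add: algebra_simps smult_add_right)
      finally have "r' = (smult (lead_coeff r ^ k) s' - q * s) * p + (smult (lead_coeff r ^ k) t' - q * t) * g" .
      moreover have "over A (smult (lead_coeff r ^ k) s' - q * s)" "over A (smult (lead_coeff r ^ k) t' - q * t)"
        using lc st st' kqr(1) by (auto intro!: over_diff over_smult over_mult)
      ultimately have "r' = 0" using rmin[of r'] kqr(4) by fastforce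
      then show ?thesis using kqr by auto
    qed
    have lc0: "lead_coeff r ^ k \<noteq> 0" for k using r by simp
    obtain k q where kq: "over A q" "smult (lead_coeff r ^ k) g = q * r"
      using divr[OF g(1)] over_0 oneA by force
    have "poly (smult (lead_coeff r ^ k) g) x = poly (q * r) x" using kq by simp
    then have rx: "poly r x \<noteq> 0" using v(2) g(2) lc0[of k] by (metis mult_eq_0_iff poly_mult poly_smult)
    obtain k' q' where kq': "over A q'" "smult (lead_coeff r ^ k') p = q' * r"
    proof -
      have "\<exists>s t. over A s \<and> over A t \<and> p = s * p + t * g"
        by (rule exI[of _ 1], rule exI[of _ 0]) (use over_0 oneA in simp)
      then show ?thesis using divr[of p] p that by blast
    qed
    have "poly (smult (lead_coeff r ^ k') p) x = poly (q' * r) x" using kq' by simp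
    \<comment> \<open>Up to a constant \<open>p\<close> is \<open>q' * r\<close> and
      \<open>r\<close> does not vanish at \<open>x\<close>, so \<open>q'\<close> is a relation too;
      minimality of \<open>p\<close> leaves degree 0 for \<open>r\<close>.\<close>
    then have q'x: "poly q' x = 0" using p rx by simp
    have "smult (lead_coeff r ^ k') p \<noteq> 0" using p lc0 by simp
    then have "q' \<noteq> 0" using kq' by auto
    then have "degree p \<le> degree q'" using pmin kq' q'x by blast
    moreover have "degree p = degree q' + degree r"
      using kq'(2) \<open>q' \<noteq> 0\<close> r lc0[of k'] by (metis degree_mult_eq degree_smult_eq)
    ultimately have "degree r = 0" by simp
    then obtain c where c: "r = [:c:]" by (rule degree_eq_zeroE)
    have "coeff r 0 \<in> A" using rA unfolding over_def by blast
    then have cA: "c \<in> A" by (simp add: c)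
    have c0: "c \<noteq> 0" using r c by auto
    have lp: "lead_coeff p \<in> A" "lead_coeff p \<noteq> 0" using p by (auto simp: over_def)
    show ?thesis
    \<comment> \<open>If \<open>lead_coeff p\<close> survives, the image of \<open>p\<close> keeps
      its positive degree and has a root \<open>\<alpha>\<close>, the image of \<open>x\<close>. If
      \<open>c\<close> survives, the Bezout relation prevents the image of \<open>g\<close> from
      vanishing at \<open>\<alpha>\<close>.\<close>
    proof (rule that[of "lead_coeff p * c"])
      show "lead_coeff p * c \<in> A" "lead_coeff p * c \<noteq> 0" using lp cA c0 Qbar_algebra_mult by auto
      fix \<phi> assume \<phi>: "Qbar_hom A \<phi>" and "\<phi> (lead_coeff p * c) \<noteq> 0"
      then have \<phi>p: "\<phi> (lead_coeff p) \<noteq> 0" and \<phi>c: "\<phi> c \<noteq> 0"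
        using Qbar_hom_mult[OF \<phi> lp(1) cA] by auto
      have "degree p \<noteq> 0"
      proof
        assume "degree p = 0"
        then obtain a where "p = [:a:]" by (rule degree_eq_zeroE)
        then show False using p by simp
      qed
      moreover have "degree (map_poly \<phi> p) = degree p"
        
        by (intro antisym degree_le allI impI le_degree)
           (use \<phi>p in \<open>auto simp: coeff_map_hom[OF \<phi>] coeff_eq_0 Qbar_hom_0[OF \<phi>]\<close>)
      ultimately have "\<not> constant (poly (map_poly \<phi> p))" by (simp add: constant_degree)
      then obtain \<alpha> where \<alpha>: "poly (map_poly \<phi> p) \<alpha> = 0"
        using fundamental_theorem_of_algebra by blast
      have "map_poly \<phi> p \<noteq> 0" using \<phi>p by (metis coeff_0 coeff_map_hom[OF \<phi>])
      then have "algebraic \<alpha>"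
        by (rule algebraic_poly_root[rotated, OF _ \<alpha>])
           (use p in \<open>auto simp: coeff_map_hom[OF \<phi>] over_def intro: Qbar_hom_range[OF \<phi>]\<close>)
      moreover have "poly (map_poly \<phi> f) \<alpha> = 0" if f: "over A f" "poly f x = 0" for f
      proof -
        obtain k q where kq: "over A q" "smult (lead_coeff p ^ k) f = q * p" using divp[OF f] by blast
        then have "map_poly \<phi> (smult (lead_coeff p ^ k) f) = map_poly \<phi> q * map_poly \<phi> p"
          using p by (simp add: map_hom_mult[OF \<phi>])
        then have "smult (\<phi> (lead_coeff p) ^ k) (map_poly \<phi> f) = map_poly \<phi> q * map_poly \<phi> p"
          using lp f by (simp add: map_hom_smult[OF \<phi>] Qbar_algebra_power Qbar_hom_power[OF \<phi>])
        then have "\<phi> (lead_coeff p) ^ k * poly (map_poly \<phi> f) \<alpha> = 0"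
          using \<alpha> by (metis mult_zero_right poly_mult poly_smult)
        then show ?thesis using \<phi>p by simp
      qed
      ultimately obtain \<psi> where \<psi>: "Qbar_hom (adjoin A x) \<psi>"
          "\<And>f. over A f \<Longrightarrow> \<psi> (poly f x) = poly (map_poly \<phi> f) \<alpha>"
        using Qbar_hom_extend[OF \<phi>] by metis
      have "poly (map_poly \<phi> r) \<alpha> = poly (map_poly \<phi> s) \<alpha> * poly (map_poly \<phi> p) \<alpha>
          + poly (map_poly \<phi> t) \<alpha> * poly (map_poly \<phi> g) \<alpha>"
        using st p g by (simp add: map_hom_add[OF \<phi>] map_hom_mult[OF \<phi>] over_mult)
      then have "poly (map_poly \<phi> g) \<alpha> \<noteq> 0"
        using \<alpha> \<phi>c c by (auto simp: map_hom_const[OF \<phi>])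
      then show "\<exists>\<psi>. Qbar_hom (adjoin A x) \<psi> \<and> \<psi> v \<noteq> 0" using \<psi> g by metis
    qed
  qed
qed

end

text \<open>The algebra is generated by \<open>S\<close>, one element being adjoined at a time;
  nonvanishing of \<open>v\<close> is traced back to nonvanishing of some \<open>u\<close> in the
  smaller algebra, and finally to the identity map on the algebraic numbers.\<close>

lemma Nullstellensatz_Qbar:
  assumes "finite S"
  shows "\<exists>A. Qbar_algebra A \<and> S \<subseteq> A \<and> (\<forall>v\<in>A. v \<noteq> 0 \<longrightarrow> (\<exists>\<phi>. Qbar_hom A \<phi> \<and> \<phi> v \<noteq> 0))"
  using assms
proof (induction S rule: finite_induct)
  case empty
  let ?K = "{k :: complex. algebraic k}"
  have "Qbar_algebra ?K" by (auto simp: Qbar_algebra_def algebraic_add_mult)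
  moreover have "Qbar_hom ?K (\<lambda>x. x)" by (auto simp: Qbar_hom_def)
  then have "\<forall>v\<in>?K. v \<noteq> 0 \<longrightarrow> (\<exists>\<phi>. Qbar_hom ?K \<phi> \<and> \<phi> v \<noteq> 0)"
    by (intro ballI impI exI[of _ "\<lambda>x. x"] conjI)
  ultimately show ?case by (intro exI[of _ ?K] conjI empty_subsetI)
next
  case (insert x S)
  from insert.IH obtain A where A: "Qbar_algebra A" "S \<subseteq> A"
      "\<forall>v\<in>A. v \<noteq> 0 \<longrightarrow> (\<exists>\<phi>. Qbar_hom A \<phi> \<and> \<phi> v \<noteq> 0)"
    by (elim exE conjE)
  have "\<exists>\<psi>. Qbar_hom (adjoin A x) \<psi> \<and> \<psi> v \<noteq> 0" if v: "v \<in> adjoin A x" "v \<noteq> 0" for v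
  proof -
    obtain u where u: "u \<in> A" "u \<noteq> 0"
      "\<And>\<phi>. Qbar_hom A \<phi> \<Longrightarrow> \<phi> u \<noteq> 0 \<Longrightarrow> \<exists>\<psi>. Qbar_hom (adjoin A x) \<psi> \<and> \<psi> v \<noteq> 0"
      by (rule Qbar_hom_extend_nonzero[OF A(1) v], rule that)
    from A(3) u(1,2) obtain \<phi> where "Qbar_hom A \<phi>" "\<phi> u \<noteq> 0" by blast
    then show ?thesis by (rule u(3))
  qed
  moreover have "insert x S \<subseteq> adjoin A x"
    using mem_adjoin[OF A(1)] subset_adjoin[OF A(1)] A(2) by blast
  ultimately show ?case
    by (intro exI[of _ "adjoin A x"] conjI Qbar_algebra_adjoin[OF A(1)]) auto
qed

section \<open>Homogeneous polynomial functions\<close>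

text \<open>This is \<open>scf\<close> for functions on an arbitrary type, so that one vector space
  structure serves coefficient vectors and polynomial functions alike.\<close>

definition fsc :: "complex \<Rightarrow> ('a \<Rightarrow> complex) \<Rightarrow> 'a \<Rightarrow> complex" where
  "fsc c f = (\<lambda>x. c * f x)"

lemma fsc_apply [simp]: "fsc c f x = c * f x"
  by (simp add: fsc_def)

interpretation fs: vector_space fsc
  by unfold_locales (auto simp: fsc_def fun_eq_iff algebra_simps)

interpretation fp: vector_space_pair fsc fsc
  by unfold_locales

lemma fsc_linearI:
  assumes "\<And>f g. T (f + g) = T f + T g" "\<And>c f. T (fsc c f) = fsc c (T f)"
  shows "Vector_Spaces.linear fsc fsc T"
  using assms by (simp add: Vector_Spaces.linear_iff fs.vector_space_axioms)

lemma sum_fun_apply: "sum f I x = (\<Sum>i\<in>I. f i x)"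
  by (induction I rule: infinite_finite_induct) auto

definition linform :: "nat \<Rightarrow> (nat \<Rightarrow> complex) \<Rightarrow> (nat \<Rightarrow> complex) \<Rightarrow> complex" where
  "linform n y x = (\<Sum>j<n. y j * x j)"

text \<open>Polynomials are functions on infinite sequences of which only the first \<open>n\<close>
  coordinates are read; the type thus stays the same when the number of variables drops.\<close>

fun mons :: "nat \<Rightarrow> nat \<Rightarrow> ((nat \<Rightarrow> complex) \<Rightarrow> complex) set" where
  "mons n 0 = {\<lambda>x. 1}"
| "mons n (Suc N) = (\<lambda>(j, f). \<lambda>x. x j * f x) ` ({..<n} \<times> mons n N)"

definition Pol :: "nat \<Rightarrow> nat \<Rightarrow> ((nat \<Rightarrow> complex) \<Rightarrow> complex) set" where
  "Pol n N = fs.span (mons n N)"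

lemma finite_mons: "finite (mons n N)"
  by (induction N) auto

lemma subspace_Pol: "fs.subspace (Pol n N)"
  by (simp add: Pol_def)

lemma fin_dim_Pol: "fin_dim fsc (Pol n N)"
  unfolding Pol_def by (rule fs.fin_dim_span[OF finite_mons])

lemma Pol_subset_subspaceI:
  assumes "fs.subspace S" "mons n N \<subseteq> S"
  shows "Pol n N \<subseteq> S"
  unfolding Pol_def by (rule fs.span_minimal[OF assms(2,1)])

lemma Pol_0: "f \<in> Pol n 0 \<Longrightarrow> f x = f y"
proof -
  have "Pol n 0 \<subseteq> {f. f x = f y}"
    by (rule Pol_subset_subspaceI) (auto simp: fs.subspace_def)
  then show "f \<in> Pol n 0 \<Longrightarrow> f x = f y" by blast
qed

lemma const_in_Pol: "(\<lambda>x. c) \<in> Pol n 0"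
proof -
  have "fsc c (\<lambda>x. 1) \<in> Pol n 0"
    unfolding Pol_def by (intro fs.span_scale fs.span_base) simp
  then show ?thesis by (simp add: fsc_def)
qed

lemma Pol_mult_coord:
  assumes "j < n" "f \<in> Pol n N"
  shows "(\<lambda>x. x j * f x) \<in> Pol n (Suc N)"
proof -
  let ?S = "{f. (\<lambda>x. x j * f x) \<in> Pol n (Suc N)}"
  have "fs.subspace ?S"
    unfolding fs.subspace_def
  proof (intro conjI ballI allI)
    show "0 \<in> ?S" using fs.subspace_0[OF subspace_Pol] by (simp add: zero_fun_def)
    show "f + g \<in> ?S" if "f \<in> ?S" "g \<in> ?S" for f g
      using fs.subspace_add[OF subspace_Pol, of _ n "Suc N"] that
      by (fastforce simp: plus_fun_def distrib_left)
    show "fsc c f \<in> ?S" if "f \<in> ?S" for c f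
      using fs.subspace_scale[OF subspace_Pol, of _ n "Suc N" c] that
      by (fastforce simp: fsc_def mult.left_commute)
  qed
  moreover have "mons n N \<subseteq> ?S"
    unfolding Pol_def using assms(1) by (auto intro!: fs.span_base simp: image_iff)
  ultimately show ?thesis using Pol_subset_subspaceI assms(2) by blast
qed

lemma Pol_mult_linform:
  assumes "f \<in> Pol n N"
  shows "(\<lambda>x. linform n c x * f x) \<in> Pol n (Suc N)"
proof -
  have "(\<lambda>x. linform n c x * f x) = (\<Sum>j<n. fsc (c j) (\<lambda>x. x j * f x))"
    by (rule ext) (simp add: linform_def sum_fun_apply sum_distrib_right mult.assoc)
  also have "\<dots> \<in> Pol n (Suc N)"
    by (intro fs.subspace_sum subspace_Pol fs.subspace_scale Pol_mult_coord assms) auto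
  finally show ?thesis .
qed

text \<open>The hyperplane \<open>linform (Suc p) y = 0\<close> is parametrized by its first \<open>p\<close> coordinates.\<close>

definition restr :: "nat \<Rightarrow> (nat \<Rightarrow> complex) \<Rightarrow> ((nat \<Rightarrow> complex) \<Rightarrow> complex) \<Rightarrow> (nat \<Rightarrow> complex) \<Rightarrow> complex" where
  "restr p y f = (\<lambda>x. f (x(p := - linform p y x / y p)))"

text \<open>Coefficients of the linear form \<open>y'\<close> on the hyperplane of \<open>y\<close>,
  after elimination of the coordinate \<open>p\<close>; see \<open>linform_restr\<close>.\<close>

definition bar :: "nat \<Rightarrow> (nat \<Rightarrow> complex) \<Rightarrow> (nat \<Rightarrow> complex) \<Rightarrow> nat \<Rightarrow> complex" where
  "bar p y y' = (\<lambda>j. y' j - y' p * y j / y p)"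

lemma linear_restr: "Vector_Spaces.linear fsc fsc (restr p y)"
  by (rule fsc_linearI) (auto simp: restr_def fun_eq_iff)

lemma linform_upd [simp]: "linform p y (x(p := c)) = linform p y x"
  by (simp add: linform_def)

lemma linform_Suc: "linform (Suc p) y x = linform p y x + y p * x p"
  by (simp add: linform_def)

lemma linform_restr: "linform (Suc p) y' (x(p := - linform p y x / y p)) = linform p (bar p y y') x"
  unfolding linform_Suc
  by (simp add: linform_def bar_def left_diff_distrib sum_subtractf sum_distrib_left sum_divide_distrib mult.assoc)

lemma linform_scale: "linform n (\<lambda>j. a * c j) x = a * linform n c x"
  by (simp add: linform_def sum_distrib_left mult.assoc)

lemma restr_Pol:
  assumes "f \<in> Pol (Suc p) N"
  shows "restr p y f \<in> Pol p N"
  using assms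
proof (induction N arbitrary: f)
  case 0
  then have "restr p y f = (\<lambda>x. f 0)" using Pol_0 by (metis restr_def)
  then show ?case by (simp add: const_in_Pol)
next
  case (Suc N)
  let ?S = "{f. restr p y f \<in> Pol p (Suc N)}"
  interpret r: Vector_Spaces.linear fsc fsc "restr p y" by (rule linear_restr)
  have "fs.subspace ?S"
    unfolding fs.subspace_def
    by (auto simp: r.add r.scale r.zero subspace_Pol fs.subspace_0 fs.subspace_add fs.subspace_scale)
  moreover have "mons (Suc p) (Suc N) \<subseteq> ?S"
  proof
    fix f assume "f \<in> mons (Suc p) (Suc N)"
    then obtain j h where j: "j < Suc p" and h: "h \<in> mons (Suc p) N" and f: "f = (\<lambda>x. x j * h x)"
      by auto
    have "restr p y h \<in> Pol p N" using Suc.IH h by (simp add: Pol_def fs.span_base)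
    then have "(\<lambda>x. x j * restr p y h x) \<in> Pol p (Suc N)" if "j < p"
      using that Pol_mult_coord by blast
    moreover have "(\<lambda>x. linform p (\<lambda>j. - y j / y p) x * restr p y h x) \<in> Pol p (Suc N)"
      using Pol_mult_linform \<open>restr p y h \<in> Pol p N\<close> by blast
    moreover have "- linform p y x / y p = linform p (\<lambda>j. - y j / y p) x" for x
      using linform_scale[of p "- 1 / y p" y x] by (simp add: divide_inverse mult.commute)
    ultimately show "f \<in> ?S"
      using j f by (cases "j < p") (auto simp: restr_def less_Suc_eq)
  qed
  ultimately show ?case using Pol_subset_subspaceI Suc.prems by blast
qed

section \<open>Division by a linear form\<close>

lemma coord_division:
  assumes "j < Suc p" and yp: "y p \<noteq> 0"
  obtains a c where "\<And>x. x j = linform (Suc p) c x + a * linform (Suc p) y x"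
    "\<And>h x. restr p y (\<lambda>x. x j * h x) x = linform (Suc p) c x * restr p y h x"
proof (cases "j < p")
  case True
  have "linform (Suc p) (\<lambda>i. if i = j then 1 else 0) x = x j" for x
    using assms(1) by (simp add: linform_def if_distrib[of "\<lambda>t. t * _"] sum.delta cong: if_cong)
  then show ?thesis
    using True by (intro that[of "\<lambda>i. if i = j then 1 else 0" 0]) (auto simp: restr_def)
next
  case False
  then have j: "j = p" using assms(1) by simp
  \<comment> \<open>On the hyperplane \<open>x p\<close> equals the form \<open>?c\<close>. Its
    coefficient at \<open>p\<close> is 0, so the substitution leaves it unchanged, and the deviation
    of \<open>x p\<close> from it is \<open>1 / y p\<close> times the form \<open>y\<close>.\<close>
  let ?c = "\<lambda>i. if i = p then 0 else - y i / y p"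
  have c: "linform (Suc p) ?c x = - linform p y x / y p" for x
    unfolding linform_def by (simp add: sum_divide_distrib sum_negf)
  show ?thesis
  proof (rule that[of ?c "1 / y p"])
    show "x j = linform (Suc p) ?c x + 1 / y p * linform (Suc p) y x" for x
      unfolding c using yp j by (simp add: linform_Suc field_simps)
    show "restr p y (\<lambda>x. x j * h x) x = linform (Suc p) ?c x * restr p y h x" for h x
      unfolding c using j by (simp add: restr_def)
  qed
qed

text \<open>The remainder is the restriction, read as a polynomial not involving \<open>x p\<close>.
  As there are no forms of degree -1, the quotient of a constant is required to be 0.\<close>

lemma Pol_division_aux:
  assumes "f \<in> Pol (Suc p) N" and yp: "y p \<noteq> 0"
  shows "\<exists>g. (N = 0 \<longrightarrow> g = 0) \<and> (\<forall>M. N = Suc M \<longrightarrow> g \<in> Pol (Suc p) M) \<and>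
    (\<forall>x. f x = restr p y f x + linform (Suc p) y x * g x)"
  using assms(1)
proof (induction N arbitrary: f)
  case 0
  then have "restr p y f x = f x" for x using Pol_0 by (metis restr_def)
  then show ?case by (intro exI[of _ 0]) auto
next
  case (Suc N)
  let ?S = "{f. \<exists>g\<in>Pol (Suc p) N. \<forall>x. f x = restr p y f x + linform (Suc p) y x * g x}"
  have "fs.subspace ?S"
    unfolding fs.subspace_def
  proof (intro conjI ballI allI)
    show "0 \<in> ?S" using fs.subspace_0[OF subspace_Pol]
      by (auto intro!: bexI[of _ 0] simp: restr_def)
    show "f1 + f2 \<in> ?S" if f12: "f1 \<in> ?S" "f2 \<in> ?S" for f1 f2
    proof -
      obtain g1 g2 where g12: "g1 \<in> Pol (Suc p) N" "g2 \<in> Pol (Suc p) N"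
        "\<And>x. f1 x = restr p y f1 x + linform (Suc p) y x * g1 x"
        "\<And>x. f2 x = restr p y f2 x + linform (Suc p) y x * g2 x"
        using f12 by blast
      have "(f1 + f2) x = restr p y (f1 + f2) x + linform (Suc p) y x * (g1 + g2) x" for x
        using g12(3)[of x] g12(4)[of x] by (simp add: restr_def distrib_left)
      then show ?thesis using fs.subspace_add[OF subspace_Pol g12(1,2)] by blast
    qed
    show "fsc c f1 \<in> ?S" if f1: "f1 \<in> ?S" for c f1
    proof -
      obtain g1 where g1: "g1 \<in> Pol (Suc p) N"
        "\<And>x. f1 x = restr p y f1 x + linform (Suc p) y x * g1 x"
        using f1 by blast
      have "fsc c f1 x = restr p y (fsc c f1) x + linform (Suc p) y x * fsc c g1 x" for x
        using g1(2)[of x] by (simp add: restr_def distrib_left mult.left_commute)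
      then show ?thesis using fs.subspace_scale[OF subspace_Pol g1(1), of c] by blast
    qed
  qed
  moreover have "mons (Suc p) (Suc N) \<subseteq> ?S"
  proof
    fix f assume "f \<in> mons (Suc p) (Suc N)"
    then obtain j h where j: "j < Suc p" and "h \<in> mons (Suc p) N" and f: "f = (\<lambda>x. x j * h x)"
      by auto
    then have h: "h \<in> Pol (Suc p) N" by (simp add: Pol_def fs.span_base)
    obtain g where g: "N = 0 \<longrightarrow> g = 0" "\<forall>M. N = Suc M \<longrightarrow> g \<in> Pol (Suc p) M"
      "\<And>x. h x = restr p y h x + linform (Suc p) y x * g x"
      using Suc.IH[OF h] by blast
    obtain a c where ac: "\<And>x. x j = linform (Suc p) c x + a * linform (Suc p) y x"
      "\<And>h x. restr p y (\<lambda>x. x j * h x) x = linform (Suc p) c x * restr p y h x"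
      by (rule coord_division[of j p y, OF j yp], rule that)
    \<comment> \<open>With \<open>c\<close> and \<open>y\<close> denoting linear forms, this
      quotient is read off from \<open>x j * h\<close> by writing \<open>x j = c + a * y\<close> and
      then, in the term with \<open>c\<close>, \<open>h = restr h + y * g\<close>.\<close>
    let ?g = "fsc a h + (\<lambda>x. linform (Suc p) c x * g x)"
    have "(\<lambda>x. linform (Suc p) c x * g x) \<in> Pol (Suc p) N"
    proof (cases N)
      case 0
      then show ?thesis using g(1) const_in_Pol[of 0] by simp
    next
      case (Suc M)
      then show ?thesis using g(2) Pol_mult_linform by blast
    qed
    then have "?g \<in> Pol (Suc p) N"
      using h subspace_Pol fs.subspace_add fs.subspace_scale by blast
    moreover have "f x = restr p y f x + linform (Suc p) y x * ?g x" for x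
    proof -
      have "f x = (linform (Suc p) c x + a * linform (Suc p) y x) * h x"
        unfolding f by (simp add: ac(1)[symmetric])
      also have "\<dots> = linform (Suc p) c x * (restr p y h x + linform (Suc p) y x * g x)
          + a * linform (Suc p) y x * h x"
        using g(3)[of x] by (simp add: distrib_right)
      finally show ?thesis
        unfolding f ac(2) by (simp add: algebra_simps)
    qed
    ultimately show "f \<in> ?S" by blast
  qed
  ultimately have "f \<in> ?S" using Pol_subset_subspaceI Suc.prems by blast
  then show ?case by auto
qed

lemma Pol_division:
  assumes "f \<in> Pol (Suc p) (Suc N)" "y p \<noteq> 0" "restr p y f = 0"
  obtains g where "g \<in> Pol (Suc p) N" "f = (\<lambda>x. linform (Suc p) y x * g x)"
proof -
  obtain g where g: "g \<in> Pol (Suc p) N" "\<And>x. f x = restr p y f x + linform (Suc p) y x * g x"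
    using Pol_division_aux[of f p "Suc N" y] assms(1,2) by blast
  have "f x = linform (Suc p) y x * g x" for x
    using g(2)[of x] unfolding assms(3) by simp
  then show ?thesis using that[OF g(1)] by blast
qed

lemma restr_linform: "y p \<noteq> 0 \<Longrightarrow> restr p y (\<lambda>x. linform (Suc p) y x * g x) = 0"
  by (auto simp: restr_def fun_eq_iff linform_Suc)

text \<open>Restriction to lines reduces questions about zeros to polynomials in one
  variable.\<close>

lemma Pol_on_line:
  assumes "f \<in> Pol n N"
  shows "\<exists>p. \<forall>t. f (\<lambda>i. x i + t * e i) = poly p t"
  using assms
proof (induction N arbitrary: f)
  case 0
  then show ?case using Pol_0 by (intro exI[of _ "[:f x:]"]) auto
next
  case (Suc N)
  let ?S = "{f. \<exists>p. \<forall>t. f (\<lambda>i. x i + t * e i) = poly p t}"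
  have "fs.subspace ?S"
    unfolding fs.subspace_def
  proof (intro conjI ballI allI)
    show "0 \<in> ?S" by (auto intro: exI[of _ 0])
    show "f + g \<in> ?S" if "f \<in> ?S" "g \<in> ?S" for f g
    proof -
      obtain p q where "\<forall>t. f (\<lambda>i. x i + t * e i) = poly p t" "\<forall>t. g (\<lambda>i. x i + t * e i) = poly q t"
        using \<open>f \<in> ?S\<close> \<open>g \<in> ?S\<close> by blast
      then show ?thesis by (auto intro!: exI[of _ "p + q"])
    qed
    show "fsc c f \<in> ?S" if "f \<in> ?S" for c f
    proof -
      obtain p where "\<forall>t. f (\<lambda>i. x i + t * e i) = poly p t"
        using \<open>f \<in> ?S\<close> by blast
      then show ?thesis by (auto intro!: exI[of _ "smult c p"])
    qed
  qed
  moreover have "mons n (Suc N) \<subseteq> ?S"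
  proof
    fix f assume "f \<in> mons n (Suc N)"
    then obtain j h where h: "h \<in> mons n N" and f: "f = (\<lambda>x. x j * h x)" by auto
    then obtain p where "\<forall>t. h (\<lambda>i. x i + t * e i) = poly p t"
      using Suc.IH[of h] by (auto simp: Pol_def fs.span_base)
    then show "f \<in> ?S" unfolding f by (auto intro!: exI[of _ "[:x j, e j:] * p"] simp: algebra_simps)
  qed
  ultimately show ?case using Pol_subset_subspaceI Suc.prems by blast
qed

text \<open>On the line through \<open>x\<close> in the direction of coordinate \<open>j\<close> the
  form has a single zero, so \<open>g\<close> vanishes at infinitely many points of the line and
  hence at \<open>x\<close>.\<close>

lemma Pol_linform_cancel:
  assumes g: "g \<in> Pol n N" and y: "j < n" "y j \<noteq> 0" and "(\<lambda>x. linform n y x * g x) = 0"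
  shows "g = 0"
proof
  fix x
  let ?e = "\<lambda>i. if i = j then 1 else 0 :: complex"
  obtain p where p: "\<forall>t. g (\<lambda>i. x i + t * ?e i) = poly p t"
    using Pol_on_line[OF g, of x ?e] by blast
  have lin: "linform n y (\<lambda>i. x i + t * ?e i) = linform n y x + t * y j" for t
  proof -
    have "linform n y (\<lambda>i. x i + t * ?e i) = (\<Sum>i<n. y i * x i + (if i = j then t * y j else 0))"
      unfolding linform_def by (intro sum.cong) (auto simp: algebra_simps)
    then show ?thesis using y(1) by (simp add: sum.distrib sum.delta linform_def)
  qed
  have "poly p t = 0" if "t \<noteq> - linform n y x / y j" for t
  proof -
    have "linform n y x + t * y j \<noteq> 0" using that y(2) by (auto simp: field_simps add_eq_0_iff2)
    then show ?thesis using fun_cong[OF assms(4), of "\<lambda>i. x i + t * ?e i"] p lin by auto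
  qed
  then have "UNIV - {- linform n y x / y j} \<subseteq> {t. poly p t = 0}" by blast
  moreover have "infinite (UNIV - {- linform n y x / y j})"
    by (simp add: infinite_UNIV_char_0)
  ultimately have "p = 0" using poly_roots_finite finite_subset by blast
  then show "g x = 0 x" using p[rule_format, of 0] by simp
qed

section \<open>Colon spaces and dimension counts\<close>

declare fsc_apply [simp del]

definition colon :: "nat \<Rightarrow> nat \<Rightarrow> (nat \<Rightarrow> complex) \<Rightarrow> ((nat \<Rightarrow> complex) \<Rightarrow> complex) set \<Rightarrow>
    ((nat \<Rightarrow> complex) \<Rightarrow> complex) set" where
  "colon n M y Q = {g \<in> Pol n M. (\<lambda>x. linform n y x * g x) \<in> Q}"

lemma linear_mult: "Vector_Spaces.linear fsc fsc (\<lambda>g x. s x * g x)"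
  by (rule fsc_linearI) (auto simp: fun_eq_iff fsc_apply algebra_simps)

lemma subspace_mult_preimage:
  assumes "fs.subspace Q"
  shows "fs.subspace {g \<in> Pol n M. (\<lambda>x. s x * g x) \<in> Q}"
proof -
  let ?S = "{g \<in> Pol n M. (\<lambda>x. s x * g x) \<in> Q}"
  interpret m: Vector_Spaces.linear fsc fsc "\<lambda>g x. s x * g x" by (rule linear_mult)
  show ?thesis
  proof (rule fs.subspaceI)
    show "0 \<in> ?S" using m.zero fs.subspace_0[OF assms] fs.subspace_0[OF subspace_Pol] by simp
    show "f + g \<in> ?S" if "f \<in> ?S" "g \<in> ?S" for f g
    proof -
      have "(\<lambda>x. s x * (f + g) x) \<in> Q"
        unfolding m.add[of f g] using that fs.subspace_add[OF assms] by blast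
      then show ?thesis using that fs.subspace_add[OF subspace_Pol] by blast
    qed
    show "fsc c f \<in> ?S" if "f \<in> ?S" for c f
    proof -
      have "(\<lambda>x. s x * fsc c f x) \<in> Q"
        unfolding m.scale[of c f] using that fs.subspace_scale[OF assms] by blast
      then show ?thesis using that fs.subspace_scale[OF subspace_Pol] by blast
    qed
  qed
qed

lemma subspace_colon: "fs.subspace Q \<Longrightarrow> fs.subspace (colon n M y Q)"
  unfolding colon_def by (rule subspace_mult_preimage)

lemma colon_subset: "colon n M y Q \<subseteq> Pol n M"
  by (auto simp: colon_def)

text \<open>The elements of \<open>Q\<close> that restrict to 0 are the multiples of the form
  \<open>y\<close> lying in \<open>Q\<close>, and division by \<open>y\<close> identifies them with
  the colon space.\<close>

lemma dim_restr_colon: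
  assumes Q: "fs.subspace Q" "Q \<subseteq> Pol (Suc p) (Suc M)" and yp: "y p \<noteq> 0"
  shows "fs.dim Q = fs.dim (restr p y ` Q) + fs.dim (colon (Suc p) M y Q)"
proof -
  let ?m = "\<lambda>g x. linform (Suc p) y x * g x"
  have "?m ` colon (Suc p) M y Q = {f \<in> Q. restr p y f = 0}"
  proof
    show "?m ` colon (Suc p) M y Q \<subseteq> {f \<in> Q. restr p y f = 0}"
      using restr_linform[of y p, OF yp] by (auto simp: colon_def)
    show "{f \<in> Q. restr p y f = 0} \<subseteq> ?m ` colon (Suc p) M y Q"
    proof
      fix f assume f: "f \<in> {f \<in> Q. restr p y f = 0}"
      then obtain g where "g \<in> Pol (Suc p) M" "f = ?m g"
        using Pol_division[of f p M y] Q(2) yp by blast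
      then show "f \<in> ?m ` colon (Suc p) M y Q" using f by (auto simp: colon_def)
    qed
  qed
  moreover have "fs.dim (?m ` colon (Suc p) M y Q) = fs.dim (colon (Suc p) M y Q)"
  proof (rule fp.dim_image_inj_fin[OF linear_mult subspace_colon[OF Q(1)]])
    show "fin_dim fsc (colon (Suc p) M y Q)"
      by (rule fs.fin_dim_subset[OF colon_subset fin_dim_Pol])
    show "g = 0" if "g \<in> colon (Suc p) M y Q" "?m g = 0" for g
      using Pol_linform_cancel[of g "Suc p" M p y] that yp colon_subset by blast
  qed
  ultimately show ?thesis
    using fp.rank_nullity[OF linear_restr[of p y] Q(1) fs.fin_dim_subset[OF Q(2) fin_dim_Pol]] by simp
qed

lemma restr_image:
  assumes "fs.subspace Q" "Q \<subseteq> Pol (Suc p) N"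
  shows "fs.subspace (restr p y ` Q)" "restr p y ` Q \<subseteq> Pol p N"
  using fp.linear_subspace_image[OF linear_restr assms(1)] restr_Pol assms(2) by blast+

lemma dim_Pol_0_le: "fs.dim (Pol n 0) \<le> 1"
proof -
  have "fs.dim (Pol n 0) \<le> card (mons n 0)"
    by (rule fs.dim_le_card) (simp_all only: Pol_def subset_refl finite_mons)
  then show ?thesis by simp
qed

text \<open>Restriction and division along the form with all coefficients 1 yield the recursion of
  Pascal's rule.\<close>

lemma dim_Pol_le: "fs.dim (Pol (Suc p) N) \<le> (N + p) choose p"
proof (induction p arbitrary: N)
  case 0
  show ?case
  proof (induction N)
    case 0
    show ?case using dim_Pol_0_le by simp
  next
    case (Suc N)
    have "restr 0 (\<lambda>_. 1) ` Pol (Suc 0) (Suc N) \<subseteq> Pol 0 (Suc N)"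
      by (rule restr_image[OF subspace_Pol subset_refl])
    then have "fs.dim (restr 0 (\<lambda>_. 1) ` Pol (Suc 0) (Suc N)) \<le> card (mons 0 (Suc N))"
      unfolding Pol_def by (rule fs.dim_le_card[OF _ finite_mons])
    then have "fs.dim (restr 0 (\<lambda>_. 1) ` Pol (Suc 0) (Suc N)) = 0" by simp
    moreover have "fs.dim (colon (Suc 0) N (\<lambda>_. 1) (Pol (Suc 0) (Suc N))) \<le> fs.dim (Pol (Suc 0) N)"
      by (rule fs.dim_mono_fin[OF colon_subset fin_dim_Pol])
    ultimately show ?case
      using dim_restr_colon[OF subspace_Pol subset_refl, of "\<lambda>_. 1" 0 N] Suc by simp
  qed
next
  case (Suc p)
  note IHp = Suc
  show ?case
  proof (induction N)
    case 0
    show ?case using dim_Pol_0_le by simp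
  next
    case (Suc N)
    let ?P = "Pol (Suc (Suc p)) (Suc N)"
    have "fs.dim (restr (Suc p) (\<lambda>_. 1) ` ?P) \<le> fs.dim (Pol (Suc p) (Suc N))"
      by (rule fs.dim_mono_fin[OF restr_image(2)[OF subspace_Pol subset_refl] fin_dim_Pol])
    also have "\<dots> \<le> (Suc N + p) choose p" by (rule IHp)
    finally have "fs.dim (restr (Suc p) (\<lambda>_. 1) ` ?P) \<le> (Suc N + p) choose p" .
    moreover have "fs.dim (colon (Suc (Suc p)) N (\<lambda>_. 1) ?P) \<le> (N + Suc p) choose Suc p"
      using fs.dim_mono_fin[OF colon_subset fin_dim_Pol] Suc le_trans by blast
    ultimately show ?case
      using dim_restr_colon[OF subspace_Pol subset_refl, of "\<lambda>_. 1" "Suc p" N] by simp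
  qed
qed

section \<open>Density of colon spaces\<close>

text \<open>In two or more variables no algebraic point avoids all algebraic hyperplanes through the
  origin. A filter expresses that any finite number of them can be avoided, including hyperplanes
  that depend on points chosen earlier.\<close>

definition generic :: "nat \<Rightarrow> (nat \<Rightarrow> complex) filter \<Rightarrow> bool" where
  "generic n FF \<longleftrightarrow> (\<forall>\<^sub>F y in FF. \<forall>j<n. algebraic (y j)) \<and>
     (\<forall>c. (\<forall>j<n. algebraic (c j)) \<and> (\<exists>j<n. c j \<noteq> 0) \<longrightarrow> (\<forall>\<^sub>F y in FF. linform n c y \<noteq> 0))"

lemma generic_mono: "generic n FF \<Longrightarrow> G \<le> FF \<Longrightarrow> generic n G"
  unfolding generic_def by (meson filter_leD)

lemma generic_coord:
  assumes "generic n FF" "j < n"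
  shows "\<forall>\<^sub>F y in FF. y j \<noteq> 0"
proof -
  let ?c = "\<lambda>i. if i = j then 1 else 0 :: complex"
  have "\<forall>i<n. algebraic (?c i)" by (simp add: algebraic_of_rat)
  moreover have "\<exists>i<n. ?c i \<noteq> 0" using assms(2) by auto
  ultimately have "\<forall>\<^sub>F y in FF. linform n ?c y \<noteq> 0"
    using assms(1)[unfolded generic_def, THEN conjunct2, rule_format, of ?c] by blast
  moreover have "linform n ?c y = y j" for y
    using assms(2) by (simp add: linform_def if_distrib[of "\<lambda>t. t * _"] sum.delta cong: if_cong)
  ultimately show ?thesis by simp
qed

lemma generic_bar:
  assumes FF: "generic (Suc p) FF" and y: "\<And>j. j < Suc p \<Longrightarrow> algebraic (y j)" "y p \<noteq> 0"
  shows "generic p (filtermap (bar p y) FF)"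
  unfolding generic_def eventually_filtermap
proof (intro conjI allI impI)
  have "\<forall>\<^sub>F y' in FF. \<forall>j<Suc p. algebraic (y' j)" using FF by (simp add: generic_def)
  then show "\<forall>\<^sub>F y' in FF. \<forall>j<p. algebraic (bar p y y' j)"
    by eventually_elim
       (use y in \<open>auto simp: bar_def intro!: algebraic_diff algebraic_divide algebraic_add_mult(2)\<close>)
  fix c :: "nat \<Rightarrow> complex"
  assume c: "(\<forall>j<p. algebraic (c j)) \<and> (\<exists>j<p. c j \<noteq> 0)"
  \<comment> \<open>The last coefficient makes the form vanish at \<open>y\<close>, so its value at
    \<open>y'\<close> depends only on \<open>bar p y y'\<close>.\<close>
  let ?c = "c(p := - linform p c y / y p)"
  have "algebraic (linform p c y)"
    unfolding linform_def using c y(1) by (intro algebraic_sum algebraic_add_mult(2)) auto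
  then have "\<forall>j<Suc p. algebraic (?c j)"
    using c y by (auto simp: less_Suc_eq simp del: divide_minus_left intro!: algebraic_divide algebraic_uminus)
  moreover have "\<exists>j<Suc p. ?c j \<noteq> 0" using c by (metis fun_upd_apply less_Suc_eq less_irrefl)
  ultimately have "\<forall>\<^sub>F y' in FF. linform (Suc p) ?c y' \<noteq> 0" using FF by (simp add: generic_def)
  moreover have "linform (Suc p) ?c y' = linform p c (bar p y y')" for y'
    unfolding linform_Suc
    by (simp add: linform_def bar_def right_diff_distrib sum_subtractf sum_distrib_left sum_divide_distrib mult_ac)
  ultimately show "\<forall>\<^sub>F y' in FF. linform p c (bar p y y') \<noteq> 0" by simp
qed

lemma restr_prod_linform:
  "restr p y (\<lambda>x. (\<Prod>i\<in>I. linform (Suc p) (z i) x) * g x)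
     = (\<lambda>x. (\<Prod>i\<in>I. linform p (bar p y (z i)) x) * restr p y g x)"
  unfolding restr_def linform_restr ..

lemma choose_Suc_diff: "(Suc M + Suc p) choose Suc p = ((M + Suc p) choose Suc p) + ((Suc M + p) choose p)"
  by simp

lemma sum_choose_diagonal: "(\<Sum>k\<le>N. (k + p) choose p) = (N + Suc p) choose Suc p"
  using choose_rising_sum(1)[of p N] by (simp add: add.commute)

text \<open>At density 0 the colon space is 0 by \<open>dim_restr_colon\<close>, and at density 1
  the bound is the trivial one by the space of all forms; the strict inequality covers the
  rest.\<close>

lemma dim_colon_le_of_strict:
  assumes strict: "\<And>M Q. fs.subspace Q \<Longrightarrow> Q \<subseteq> Pol (Suc p) (Suc M) \<Longrightarrow>
      0 < fs.dim Q \<Longrightarrow> fs.dim Q < (Suc M + p) choose p \<Longrightarrow>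
      \<forall>\<^sub>F y in FF. fs.dim (colon (Suc p) M y Q) * ((Suc M + p) choose p) < fs.dim Q * ((M + p) choose p)"
    and FF: "generic (Suc p) FF" and Q: "fs.subspace Q" "Q \<subseteq> Pol (Suc p) (Suc M)"
  shows "\<forall>\<^sub>F y in FF. fs.dim (colon (Suc p) M y Q) * ((Suc M + p) choose p) \<le> fs.dim Q * ((M + p) choose p)"
proof -
  have le: "fs.dim Q \<le> (Suc M + p) choose p"
    using fs.dim_mono_fin[OF Q(2) fin_dim_Pol] dim_Pol_le[of p "Suc M"] by linarith
  consider "fs.dim Q = 0" | "fs.dim Q = (Suc M + p) choose p" | "0 < fs.dim Q" "fs.dim Q < (Suc M + p) choose p"
    using le by linarith
  then show ?thesis
  proof cases
    case 1
    have "\<forall>\<^sub>F y in FF. y p \<noteq> 0" using generic_coord[OF FF] by simp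
    then show ?thesis
      by eventually_elim (use dim_restr_colon[OF Q] 1 in simp)
  next
    case 2
    have "fs.dim (colon (Suc p) M y Q) \<le> (M + p) choose p" for y
      using fs.dim_mono_fin[OF colon_subset fin_dim_Pol] dim_Pol_le[of p M] le_trans by blast
    then show ?thesis using 2 by (simp add: mult.commute)
  next
    case 3
    then show ?thesis using strict[OF Q] by (auto elim: eventually_mono)
  qed
qed

text \<open>Transitivity of the densities \<open>X / d' \<le> g / d \<le> a / C1\<close>, cleared of
  denominators.\<close>

lemma mult_ratio_le:
  fixes X g a C1 d d' :: nat
  assumes "X * d \<le> g * d'" "g * C1 \<le> a * d" "0 < d"
  shows "X * C1 \<le> a * d'"
proof -
  have "(X * C1) * d \<le> (g * d') * C1" using mult_le_mono1[OF assms(1), of C1] by (simp add: mult_ac)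
  also have "\<dots> \<le> (a * d) * d'" using mult_le_mono1[OF assms(2), of d'] by (simp add: mult_ac)
  finally have "(X * C1) * d \<le> (a * d') * d" by (simp add: mult_ac)
  then show ?thesis using assms(3) by simp
qed

lemma mult_ratio_less:
  fixes X g a C1 d d' :: nat
  assumes "X * d < g * d'" "g * C1 \<le> a * d" "0 < C1"
  shows "X * C1 < a * d'"
proof -
  have "(X * C1) * d < (g * d') * C1" using assms by (simp add: mult_ac)
  also have "\<dots> \<le> (a * d) * d'" using mult_le_mono1[OF assms(2), of d'] by (simp add: mult_ac)
  finally have "(X * C1) * d < (a * d') * d" by (simp add: mult_ac)
  then show ?thesis by (metis mult_less_cancel2)
qed

text \<open>A subspace \<open>Q\<close> that is destabilized by every \<open>y\<close> of a generic filter is restricted to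
  hyperplanes \<open>ys 0, \<dots>, ys N\<close>, each one generic relative to the preceding ones.\<close>

locale destabilized =
  fixes p M :: nat and FF :: "(nat \<Rightarrow> complex) filter" and Q :: "((nat \<Rightarrow> complex) \<Rightarrow> complex) set"
  assumes FF: "generic (Suc (Suc p)) FF" "FF \<noteq> bot"
    and Q: "fs.subspace Q" "Q \<subseteq> Pol (Suc (Suc p)) (Suc M)"
    and dim_Q: "0 < fs.dim Q" "fs.dim Q < (Suc M + Suc p) choose Suc p"
    and bad: "\<forall>\<^sub>F y in FF. fs.dim Q * ((M + Suc p) choose Suc p)
        \<le> fs.dim (colon (Suc (Suc p)) M y Q) * ((Suc M + Suc p) choose Suc p)"
    and IH: "\<And>FF M Q. generic (Suc p) FF \<Longrightarrow> fs.subspace Q \<Longrightarrow> Q \<subseteq> Pol (Suc p) (Suc M) \<Longrightarrow>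
      0 < fs.dim Q \<Longrightarrow> fs.dim Q < (Suc M + p) choose p \<Longrightarrow>
      \<forall>\<^sub>F y in FF. fs.dim (colon (Suc p) M y Q) * ((Suc M + p) choose p) < fs.dim Q * ((M + p) choose p)"
begin

abbreviation "N \<equiv> Suc M"
abbreviation "C1 \<equiv> (N + Suc p) choose Suc p"

definition bad_pt :: "(nat \<Rightarrow> complex) \<Rightarrow> bool" where
  "bad_pt y \<longleftrightarrow> (\<forall>j<Suc (Suc p). algebraic (y j)) \<and> y (Suc p) \<noteq> 0 \<and>
     fs.dim (restr (Suc p) y ` Q) * C1 \<le> fs.dim Q * ((N + p) choose p)"

text \<open>Here the division by the later forms takes place after the restriction to
  \<open>ys k\<close>, whereas in \<open>H\<close> no restriction is made. Thus \<open>G\<close>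
  lives on the hyperplane, where the induction hypothesis applies, and for \<open>l = N\<close> it
  contains the restriction of \<open>H ys k\<close>.\<close>

definition G :: "(nat \<Rightarrow> nat \<Rightarrow> complex) \<Rightarrow> nat \<Rightarrow> nat \<Rightarrow> ((nat \<Rightarrow> complex) \<Rightarrow> complex) set" where
  "G ys k l = {g \<in> Pol (Suc p) (N + k - l).
     (\<lambda>x. (\<Prod>i\<in>{k<..l}. linform (Suc p) (bar (Suc p) (ys k) (ys i)) x) * g x) \<in> restr (Suc p) (ys k) ` Q}"

definition H :: "(nat \<Rightarrow> nat \<Rightarrow> complex) \<Rightarrow> nat \<Rightarrow> ((nat \<Rightarrow> complex) \<Rightarrow> complex) set" where
  "H ys k = {g \<in> Pol (Suc (Suc p)) k. (\<lambda>x. (\<Prod>i\<in>{k<..N}. linform (Suc (Suc p)) (ys i) x) * g x) \<in> Q}"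

text \<open>The dimensions of restriction and colon space add up to \<open>dim Q\<close>, and by
  Pascal's rule so do those of the ambient spaces; a colon space at least as dense as
  \<open>Q\<close> forces a restriction at most as dense.\<close>

lemma eventually_bad_pt: "\<forall>\<^sub>F y in FF. bad_pt y"
proof -
  have "\<forall>\<^sub>F y in FF. \<forall>j<Suc (Suc p). algebraic (y j)" using FF(1) unfolding generic_def by blast
  moreover have "\<forall>\<^sub>F y in FF. y (Suc p) \<noteq> 0" using generic_coord[OF FF(1)] by simp
  ultimately show ?thesis using bad
  proof eventually_elim
    case (elim y)
    let ?r = "fs.dim (restr (Suc p) y ` Q)" and ?c = "fs.dim (colon (Suc (Suc p)) M y Q)"
    have "fs.dim Q = ?r + ?c" using dim_restr_colon[OF Q] elim(2) by blast
    then have "?r * C1 + ?c * C1 = fs.dim Q * C1" by (simp add: add_mult_distrib)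
    also have "\<dots> = fs.dim Q * ((M + Suc p) choose Suc p) + fs.dim Q * ((N + p) choose p)"
      by (metis add_mult_distrib2 choose_Suc_diff)
    finally have "?r * C1 \<le> fs.dim Q * ((N + p) choose p)" using elim(3) by linarith
    then show ?case using elim unfolding bad_pt_def by blast
  qed
qed

lemma G_diag: "G ys k k = restr (Suc p) (ys k) ` Q"
  using restr_image(2)[OF Q] by (auto simp: G_def)

lemma G_subspace: "fs.subspace (G ys k l)"
  unfolding G_def by (rule subspace_mult_preimage[OF restr_image(1)[OF Q]])

lemma G_Suc:
  assumes "k \<le> l" "l < N"
  shows "G (ys(Suc l := y)) k (Suc l) = colon (Suc p) (N + k - Suc l) (bar (Suc p) (ys k) y) (G ys k l)"
proof -
  let ?L = "\<lambda>z. linform (Suc p) (bar (Suc p) (ys k) z)"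
  have deg: "N + k - l = Suc (N + k - Suc l)" using assms by simp
  have "(\<Prod>i\<in>{k<..Suc l}. ?L ((ys(Suc l := y)) i) x) = (\<Prod>i\<in>{k<..l}. ?L (ys i) x) * ?L y x" for x
  proof -
    have "{k<..Suc l} = insert (Suc l) {k<..l}" using assms by auto
    then show ?thesis by (simp add: mult.commute)
  qed
  then show ?thesis
    using assms Pol_mult_linform unfolding G_def colon_def deg by (auto simp: mult.assoc)
qed

text \<open>A new point must be generic on each of the finitely many earlier hyperplanes, where one
  more colon does not increase the density. Strictness is recorded only for the newest pair, since
  it is used for \<open>G ys M N\<close> alone.\<close>

lemma chain_exists:
  assumes "l \<le> N"
  shows "\<exists>ys. (\<forall>k\<le>l. bad_pt (ys k)) \<and> (\<forall>k\<le>l. fs.dim (G ys k l) * C1 \<le> fs.dim Q * ((N + k - l + p) choose p))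
    \<and> (l \<ge> 1 \<longrightarrow> fs.dim (G ys (l - 1) l) * C1 < fs.dim Q * ((M + p) choose p))"
  using assms
proof (induction l)
  case 0
  obtain y where "bad_pt y" using eventually_happens'[OF FF(2) eventually_bad_pt] by blast
  then show ?case by (intro exI[of _ "\<lambda>_. y"]) (auto simp: G_diag bad_pt_def)
next
  case (Suc l)
  then obtain ys where bad_ys: "\<And>k. k \<le> l \<Longrightarrow> bad_pt (ys k)"
    and dens: "\<And>k. k \<le> l \<Longrightarrow> fs.dim (G ys k l) * C1 \<le> fs.dim Q * ((N + k - l + p) choose p)"
    by auto
  let ?col = "\<lambda>k y. colon (Suc p) (N + k - Suc l) (bar (Suc p) (ys k) y) (G ys k l)"
  have gen: "generic (Suc p) (filtermap (bar (Suc p) (ys k)) FF)" if "k \<le> l" for k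
    using bad_ys[OF that] by (intro generic_bar FF) (auto simp: bad_pt_def)
  have G_Pol: "G ys k l \<subseteq> Pol (Suc p) (Suc (N + k - Suc l))" if "k \<le> l" for k
  proof -
    have "N + k - l = Suc (N + k - Suc l)" using that Suc.prems by simp
    then show ?thesis by (auto simp: G_def)
  qed
  have le: "\<forall>\<^sub>F y in FF. fs.dim (?col k y) * C1 \<le> fs.dim Q * ((N + k - Suc l + p) choose p)" if k: "k \<le> l" for k
  proof -
    have deg: "Suc (N + k - Suc l) = N + k - l" using k Suc.prems by simp
    have "\<forall>\<^sub>F y in FF. fs.dim (?col k y) * ((Suc (N + k - Suc l) + p) choose p)
        \<le> fs.dim (G ys k l) * ((N + k - Suc l + p) choose p)"
      using dim_colon_le_of_strict[OF IH[OF gen[OF k]] gen[OF k] G_subspace G_Pol[OF k]]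
      by (simp add: eventually_filtermap)
    then show ?thesis
      unfolding deg by eventually_elim (rule mult_ratio_le[OF _ dens[OF k]], auto)
  qed
  \<comment> \<open>\<open>G ys l l\<close> is the restriction of \<open>Q\<close>, of density at
    most that of \<open>Q\<close> and hence below 1. Unless it is zero, the induction hypothesis is
    strict; if it is zero, strictness comes from \<open>dim_Q\<close>.\<close>
  have less: "\<forall>\<^sub>F y in FF. fs.dim (?col l y) * C1 < fs.dim Q * ((M + p) choose p)"
  proof (cases "fs.dim (G ys l l) = 0")
    case True
    then have "\<forall>\<^sub>F y in FF. fs.dim (?col l y) * ((Suc (N + l - Suc l) + p) choose p) \<le> 0"
      using dim_colon_le_of_strict[OF IH[OF gen[OF order_refl]] gen[OF order_refl] G_subspace G_Pol[OF order_refl]]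
      by (simp add: eventually_filtermap)
    then show ?thesis by eventually_elim (use dim_Q in simp)
  next
    case False
    have dl: "fs.dim (G ys l l) * C1 \<le> fs.dim Q * ((N + p) choose p)" using dens[of l] by simp
    also have "\<dots> < C1 * ((N + p) choose p)" using dim_Q by simp
    finally have "fs.dim (G ys l l) < (Suc (N + l - Suc l) + p) choose p" by (simp add: mult.commute)
    then have "\<forall>\<^sub>F y in FF. fs.dim (?col l y) * ((Suc (N + l - Suc l) + p) choose p)
        < fs.dim (G ys l l) * ((N + l - Suc l + p) choose p)"
      using IH[OF gen[OF order_refl] G_subspace G_Pol[OF order_refl]] False by (simp add: eventually_filtermap)
    then show ?thesis
    proof eventually_elim
      case (elim y)
      have "fs.dim (?col l y) * ((N + p) choose p) < fs.dim (G ys l l) * ((M + p) choose p)"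
        using elim by simp
      then show ?case by (rule mult_ratio_less[OF _ dl]) simp
    qed
  qed
  have "\<forall>\<^sub>F y in FF. \<forall>k\<in>{..l}. fs.dim (?col k y) * C1 \<le> fs.dim Q * ((N + k - Suc l + p) choose p)"
    by (rule eventually_ball_finite) (use le in auto)
  then have "\<forall>\<^sub>F y in FF. bad_pt y \<and> fs.dim (?col l y) * C1 < fs.dim Q * ((M + p) choose p) \<and>
      (\<forall>k\<in>{..l}. fs.dim (?col k y) * C1 \<le> fs.dim Q * ((N + k - Suc l + p) choose p))"
    using eventually_bad_pt less by eventually_elim blast
  then obtain y where y: "bad_pt y" "fs.dim (?col l y) * C1 < fs.dim Q * ((M + p) choose p)"
      "\<And>k. k \<le> l \<Longrightarrow> fs.dim (?col k y) * C1 \<le> fs.dim Q * ((N + k - Suc l + p) choose p)"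
    using eventually_happens'[OF FF(2)] by fastforce
  let ?ys = "ys(Suc l := y)"
  have G: "G ?ys k (Suc l) = ?col k y" if "k \<le> l" for k using G_Suc that Suc.prems by simp
  have "bad_pt (?ys k)" if "k \<le> Suc l" for k using bad_ys y(1) that by (auto simp: le_Suc_eq)
  moreover have "fs.dim (G ?ys k (Suc l)) * C1 \<le> fs.dim Q * ((N + k - Suc l + p) choose p)" if "k \<le> Suc l" for k
  proof (cases "k \<le> l")
    case True
    then show ?thesis using G y(3) by simp
  next
    case False
    then have "k = Suc l" using that by simp
    then show ?thesis using y(1) by (simp add: G_diag bad_pt_def)
  qed
  moreover have "fs.dim (G ?ys (Suc l - 1) (Suc l)) * C1 < fs.dim Q * ((M + p) choose p)"
    using G[of l] y(2) by simp
  ultimately show ?case by blast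
qed

lemma H_subspace: "fs.subspace (H ys k)"
  unfolding H_def by (rule subspace_mult_preimage[OF Q(1)])

lemma H_top: "H ys N = Q"
  using Q(2) by (auto simp: H_def)

lemma H_subset: "H ys k \<subseteq> Pol (Suc (Suc p)) k"
  by (auto simp: H_def)

text \<open>Restriction is multiplicative, so dividing first and restricting afterwards stays within
  the result of the opposite order.\<close>

lemma restr_H: "restr (Suc p) (ys k) ` H ys k \<subseteq> G ys k N"
proof
  fix f assume "f \<in> restr (Suc p) (ys k) ` H ys k"
  then obtain g where g: "g \<in> H ys k" "f = restr (Suc p) (ys k) g" by blast
  have "restr (Suc p) (ys k) (\<lambda>x. (\<Prod>i\<in>{k<..N}. linform (Suc (Suc p)) (ys i) x) * g x) \<in> restr (Suc p) (ys k) ` Q"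
    using g(1) by (auto simp: H_def)
  moreover have "f \<in> Pol (Suc p) k" unfolding g(2) using g(1) H_subset restr_Pol by blast
  ultimately show "f \<in> G ys k N" using g(2) by (simp add: restr_prod_linform G_def)
qed

lemma dim_restr_H: "fs.dim (restr (Suc p) (ys k) ` H ys k) \<le> fs.dim (G ys k N)"
  by (rule fs.dim_mono_fin[OF restr_H fs.fin_dim_subset[OF _ fin_dim_Pol]]) (auto simp: G_def)

lemma colon_H:
  assumes "Suc k \<le> N"
  shows "colon (Suc (Suc p)) k (ys (Suc k)) (H ys (Suc k)) = H ys k"
proof -
  have "{k<..N} = insert (Suc k) {Suc k<..N}" using assms by auto
  then have "(\<Prod>i\<in>{k<..N}. linform (Suc (Suc p)) (ys i) x)
      = (\<Prod>i\<in>{Suc k<..N}. linform (Suc (Suc p)) (ys i) x) * linform (Suc (Suc p)) (ys (Suc k)) x" for x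
    by (simp add: mult.commute)
  then show ?thesis
    using Pol_mult_linform unfolding colon_def H_def by (auto simp: mult.assoc)
qed

text \<open>Each step splits off the restriction to \<open>ys (Suc k)\<close> and leaves
  \<open>H ys k\<close> as the colon space; at the bottom, constants restrict injectively.\<close>

lemma dim_H_le:
  assumes "\<And>i. i \<le> N \<Longrightarrow> ys i (Suc p) \<noteq> 0" "k \<le> N"
  shows "fs.dim (H ys k) \<le> (\<Sum>i\<le>k. fs.dim (G ys i N))"
  using assms(2)
proof (induction k)
  case 0
  have "g = 0" if "g \<in> H ys 0" "restr (Suc p) (ys 0) g = 0" for g
  proof
    fix x
    have "g x = restr (Suc p) (ys 0) g x" using that(1) H_subset Pol_0 unfolding restr_def by blast
    then show "g x = 0 x" using that(2) by simp
  qed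
  then have "fs.dim (restr (Suc p) (ys 0) ` H ys 0) = fs.dim (H ys 0)"
    by (intro fp.dim_image_inj_fin linear_restr H_subspace fs.fin_dim_subset[OF H_subset fin_dim_Pol])
  then show ?case using dim_restr_H[of ys 0] by simp
next
  case (Suc k)
  have "fs.dim (H ys (Suc k)) = fs.dim (restr (Suc p) (ys (Suc k)) ` H ys (Suc k)) + fs.dim (H ys k)"
    using dim_restr_colon[OF H_subspace H_subset, of "ys (Suc k)"] assms(1) Suc.prems colon_H by simp
  then show ?case using dim_restr_H[of ys "Suc k"] Suc by simp
qed

lemma contradiction: False
proof -
  obtain ys where ys: "\<And>k. k \<le> N \<Longrightarrow> bad_pt (ys k)"
      "\<And>k. k \<le> N \<Longrightarrow> fs.dim (G ys k N) * C1 \<le> fs.dim Q * ((k + p) choose p)"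
      "fs.dim (G ys M N) * C1 < fs.dim Q * ((M + p) choose p)"
    using chain_exists[of N] by auto
  have "fs.dim Q \<le> (\<Sum>k\<le>N. fs.dim (G ys k N))"
    using dim_H_le[of ys N] ys(1) H_top by (simp add: bad_pt_def)
  then have "fs.dim Q * C1 \<le> (\<Sum>k\<le>N. fs.dim (G ys k N) * C1)"
    by (metis mult_le_mono1 sum_distrib_right)
  \<comment> \<open>The strict term is \<open>k = M\<close>; the resulting sum of binomial
    coefficients is the hockey-stick sum \<open>C1\<close>.\<close>
  also have "\<dots> < (\<Sum>k\<le>N. fs.dim Q * ((k + p) choose p))"
    by (rule sum_strict_mono_ex1) (use ys in auto)
  also have "\<dots> = fs.dim Q * C1"
    by (simp only: sum_distrib_left[symmetric] sum_choose_diagonal)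
  finally show False by simp
qed

end

theorem colon_density:
  assumes "generic (Suc p) FF" "fs.subspace Q" "Q \<subseteq> Pol (Suc p) (Suc M)"
    "0 < fs.dim Q" "fs.dim Q < (Suc M + p) choose p"
  shows "\<forall>\<^sub>F y in FF. fs.dim (colon (Suc p) M y Q) * ((Suc M + p) choose p) < fs.dim Q * ((M + p) choose p)"
  using assms
proof (induction p arbitrary: FF M Q)
  case 0
  \<comment> \<open>For one variable the binomial coefficient is 1, and no dimension lies strictly
    between 0 and 1.\<close>
  then show ?case by simp
next
  case (Suc p)
  let ?good = "\<lambda>y. fs.dim (colon (Suc (Suc p)) M y Q) * ((Suc M + Suc p) choose Suc p)
      < fs.dim Q * ((M + Suc p) choose Suc p)"
  show ?case
  proof (rule ccontr)
    assume not_good: "\<not> (\<forall>\<^sub>F y in FF. ?good y)"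
    \<comment> \<open>If the claim is not eventually true, the filter can be refined to the bad
      points without becoming trivial. Being finer it is still generic, so generic choices from it
      are all bad.\<close>
    let ?FF = "inf FF (principal {y. \<not> ?good y})"
    interpret destabilized p M ?FF Q
    proof
      show "generic (Suc (Suc p)) ?FF" by (rule generic_mono[OF Suc.prems(1)]) simp
      show "?FF \<noteq> bot"
        using not_good by (simp add: trivial_limit_def eventually_inf_principal)
      show "\<forall>\<^sub>F y in ?FF. fs.dim Q * ((M + Suc p) choose Suc p)
          \<le> fs.dim (colon (Suc (Suc p)) M y Q) * ((Suc M + Suc p) choose Suc p)"
        by (simp add: eventually_inf_principal not_less)
    qed (use Suc in auto)
    show False by (rule contradiction)
  qed
qed

section \<open>Duality\<close>

text \<open>This is \<open>CO\<close> over an arbitrary index type; in \<open>dim_perp\<close> the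
  index set is also a basis consisting of functions.\<close>

definition supp_on :: "'a set \<Rightarrow> ('a \<Rightarrow> complex) set" where
  "supp_on J = {f. \<forall>x. x \<notin> J \<longrightarrow> f x = 0}"

definition ev :: "'a \<Rightarrow> 'a \<Rightarrow> complex" where
  "ev k = (\<lambda>x. if x = k then 1 else 0)"

lemma subspace_supp_on: "fs.subspace (supp_on J)"
  by (rule fs.subspaceI) (auto simp: supp_on_def fsc_apply)

lemma supp_on_expand:
  assumes "finite J" "f \<in> supp_on J"
  shows "f = (\<Sum>k\<in>J. fsc (f k) (ev k))"
proof
  fix x
  have "(\<Sum>k\<in>J. fsc (f k) (ev k)) x = (\<Sum>k\<in>J. if x = k then f k else 0)"
    by (simp add: sum_fun_apply fsc_apply ev_def if_distrib cong: if_cong)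
  also have "\<dots> = f x" using assms by (simp add: sum.delta' supp_on_def)
  finally show "f x = (\<Sum>k\<in>J. fsc (f k) (ev k)) x" by simp
qed

lemma supp_on_basis:
  assumes "finite J"
  shows "supp_on J = fs.span (ev ` J)" "fs.dim (supp_on J) = card J" "fin_dim fsc (supp_on J)"
proof -
  have inj: "inj_on ev J" by (rule inj_onI) (metis ev_def zero_neq_one)
  have sub: "supp_on J \<subseteq> fs.span (ev ` J)"
  proof
    fix f assume "f \<in> supp_on J"
    then have "f = (\<Sum>k\<in>J. fsc (f k) (ev k))" by (rule supp_on_expand[OF assms])
    also have "\<dots> \<in> fs.span (ev ` J)" by (intro fs.span_sum fs.span_scale fs.span_base) auto
    finally show "f \<in> fs.span (ev ` J)" .
  qed
  have ev: "ev ` J \<subseteq> supp_on J" by (auto simp: supp_on_def ev_def)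
  then show span: "supp_on J = fs.span (ev ` J)"
    using sub fs.span_minimal[OF ev subspace_supp_on] by blast
  show "fin_dim fsc (supp_on J)" unfolding span by (rule fs.fin_dim_span) (simp add: assms)
  have "fs.independent (ev ` J)"
  proof (rule fs.independent_if_scalars_zero)
    fix u v assume s: "(\<Sum>v\<in>ev ` J. fsc (u v) v) = 0" and v: "v \<in> ev ` J"
    then obtain k where k: "k \<in> J" "v = ev k" by blast
    have "0 = (\<Sum>v\<in>ev ` J. fsc (u v) v) k" using s by simp
    also have "\<dots> = (\<Sum>i\<in>J. if k = i then u (ev i) else 0)"
      unfolding sum.reindex[OF inj] o_def sum_fun_apply fsc_apply
      by (intro sum.cong) (auto simp: ev_def)
    also have "\<dots> = u v" using k assms by (simp add: sum.delta')
    finally show "u v = 0" by simp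
  qed (simp add: assms)
  then show "fs.dim (supp_on J) = card J"
    using fs.basis_card_eq_dim[OF ev sub] inj by (simp add: card_image)
qed

text \<open>The pairing is bilinear, not Hermitian: \<open>V\<close> may meet its annihilator, and
  only the dimensions are complementary.\<close>

definition perp :: "'a set \<Rightarrow> ('a \<Rightarrow> complex) set \<Rightarrow> ('a \<Rightarrow> complex) set" where
  "perp J V = {q \<in> supp_on J. \<forall>v\<in>V. (\<Sum>k\<in>J. v k * q k) = 0}"

text \<open>The annihilator is the kernel of the pairing \<open>T\<close> with a basis of
  \<open>V\<close>, and \<open>T\<close> is onto because a functional can be prescribed freely on
  independent vectors.\<close>

lemma dim_perp:
  assumes J: "finite J" and V: "fs.subspace V" "V \<subseteq> supp_on J"
  shows "fs.dim (perp J V) + fs.dim V = card J" "fs.subspace (perp J V)"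
proof -
  obtain B where B: "finite B" "B \<subseteq> V" "fs.independent B" "fs.span B = V" "card B = fs.dim V"
    using fs.fin_dim_basis[OF V(1) fs.fin_dim_subset[OF V(2) supp_on_basis(3)[OF J]]] by blast
  define T where "T q = (\<lambda>b. if b \<in> B then \<Sum>k\<in>J. b k * q k else 0)" for q :: "'a \<Rightarrow> complex"
  have lin: "Vector_Spaces.linear fsc fsc T"
    by (rule fsc_linearI)
       (auto simp: T_def fun_eq_iff fsc_apply algebra_simps sum.distrib sum_distrib_left)
  have "(\<forall>v\<in>V. (\<Sum>k\<in>J. v k * q k) = 0) \<longleftrightarrow> T q = 0" for q
  proof
    assume "\<forall>v\<in>V. (\<Sum>k\<in>J. v k * q k) = 0"
    then show "T q = 0" using B(2) by (auto simp: T_def fun_eq_iff)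
  next
    assume T0: "T q = 0"
    have "fs.subspace {v. (\<Sum>k\<in>J. v k * q k) = 0}"
      by (rule fs.subspaceI) (auto simp: fsc_apply distrib_right sum.distrib mult.assoc sum_distrib_left[symmetric])
    moreover have "B \<subseteq> {v. (\<Sum>k\<in>J. v k * q k) = 0}"
    proof
      fix b assume "b \<in> B"
      then show "b \<in> {v. (\<Sum>k\<in>J. v k * q k) = 0}" using fun_cong[OF T0, of b] by (simp add: T_def)
    qed
    ultimately show "\<forall>v\<in>V. (\<Sum>k\<in>J. v k * q k) = 0"
      using fs.span_minimal B(4) by blast
  qed
  then have perp: "perp J V = {q \<in> supp_on J. T q = 0}" by (auto simp: perp_def)
  show "fs.subspace (perp J V)"
    unfolding perp by (rule fp.linear_subspace_ker[OF lin subspace_supp_on])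
  have "T ` supp_on J = supp_on B"
  proof
    show "T ` supp_on J \<subseteq> supp_on B" by (auto simp: T_def supp_on_def)
    show "supp_on B \<subseteq> T ` supp_on J"
    proof
      fix c assume c: "c \<in> supp_on B"
      \<comment> \<open>The functional takes values in functions on \<open>unit\<close>, so that its
        target also carries the scalar multiplication \<open>fsc\<close>.\<close>
      obtain g :: "('a \<Rightarrow> complex) \<Rightarrow> unit \<Rightarrow> complex" where
        g: "Vector_Spaces.linear fsc fsc g" "\<forall>b\<in>B. g b = (\<lambda>_. c b)"
        using fp.linear_independent_extend[OF B(3), of "\<lambda>b _. c b"] by blast
      interpret g: Vector_Spaces.linear fsc fsc g by (rule g)
      define q where "q k = (if k \<in> J then g (ev k) () else 0)" for k
      have "T q b = c b" for b
      proof (cases "b \<in> B")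
        case True
        then have "b = (\<Sum>k\<in>J. fsc (b k) (ev k))" using supp_on_expand[OF J] B(2) V(2) by blast
        then have "g b = g (\<Sum>k\<in>J. fsc (b k) (ev k))" by simp
        also have "\<dots> = (\<Sum>k\<in>J. fsc (b k) (g (ev k)))" by (simp add: g.sum g.scale)
        finally have "c b = (\<Sum>k\<in>J. b k * g (ev k) ())"
          using g(2) True by (simp add: sum_fun_apply fsc_apply fun_eq_iff)
        then show ?thesis using True by (simp add: T_def q_def)
      qed (use c in \<open>auto simp: T_def supp_on_def\<close>)
      moreover have "q \<in> supp_on J" by (simp add: q_def supp_on_def)
      ultimately show "c \<in> T ` supp_on J" by (metis ext image_eqI)
    qed
  qed
  then show "fs.dim (perp J V) + fs.dim V = card J"
    using fp.rank_nullity[OF lin subspace_supp_on supp_on_basis(3)[OF J]]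
      supp_on_basis(2)[OF J] supp_on_basis(2)[OF B(1)] B(5) perp by simp
qed

section \<open>Multi-indices and shifts by unit vectors\<close>

lemma finite_Theta: "finite (Theta m N)"
proof -
  have "Theta m N \<subseteq> {k. set k \<subseteq> {..N} \<and> length k = m}"
    using member_le_sum_list by (fastforce simp: Theta_def)
  then show ?thesis using finite_lists_length_eq[of "{..N}" m] finite_subset by blast
qed

lemma card_Theta: "card (Theta (Suc p) N) = (N + p) choose p"
proof -
  have "card (Theta (Suc p) N) = (N + Suc p - 1) choose N"
    unfolding Theta_def by (rule card_length_sum_list)
  also have "\<dots> = (N + p) choose p" using binomial_symmetric[of N "N + p"] by simp
  finally show ?thesis .
qed

lemma sum_list_upd_nat: "j < length (k :: nat list) \<Longrightarrow> sum_list (k[j := a]) + k ! j = sum_list k + a"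
proof (induction k arbitrary: j)
  case (Cons b k)
  then show ?case by (cases j) auto
qed simp

definition up :: "nat \<Rightarrow> nat list \<Rightarrow> nat list" where
  "up j k = k[j := Suc (k ! j)]"

lemma up_Theta: "j < m \<Longrightarrow> l \<in> Theta m M \<Longrightarrow> up j l \<in> Theta m (Suc M)"
  using sum_list_upd_nat[of j l "Suc (l ! j)"] by (simp add: Theta_def up_def)

lemma up_eq_iff:
  assumes "j < m" "l \<in> Theta m M" "k \<in> Theta m (Suc M)"
  shows "up j l = k \<longleftrightarrow> k ! j \<noteq> 0 \<and> l = k[j := k ! j - 1]"
  using assms by (auto simp: up_def Theta_def list_eq_iff_nth_eq nth_list_update split: if_splits)

lemma down_Theta:
  assumes "j < m" "k \<in> Theta m (Suc M)" "k ! j \<noteq> 0"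
  shows "k[j := k ! j - 1] \<in> Theta m M"
  using sum_list_upd_nat[of j k "k ! j - 1"] assms by (simp add: Theta_def)

text \<open>Pairs of \<open>k\<close> and \<open>j\<close> with \<open>k ! j \<noteq> 0\<close>
  correspond to pairs of \<open>l\<close> and \<open>j\<close> through \<open>k = up j l\<close>.
  This reindexing serves both for products with a linear form and for their transposes.\<close>

lemma sum_Theta_shift:
  fixes f :: "nat \<Rightarrow> nat list \<Rightarrow> nat list \<Rightarrow> complex"
  shows "(\<Sum>k\<in>Theta m (Suc M). \<Sum>j<m. if k ! j = 0 then 0 else f j (k[j := k ! j - 1]) k)
    = (\<Sum>l\<in>Theta m M. \<Sum>j<m. f j l (up j l))"
proof -
  have "(\<Sum>k\<in>Theta m (Suc M). if k ! j = 0 then 0 else f j (k[j := k ! j - 1]) k)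
      = (\<Sum>l\<in>Theta m M. f j l (up j l))" if j: "j < m" for j
  proof -
    have "(\<Sum>k\<in>Theta m (Suc M). if k ! j = 0 then 0 else f j (k[j := k ! j - 1]) k)
        = (\<Sum>k\<in>{k \<in> Theta m (Suc M). k ! j \<noteq> 0}. f j (k[j := k ! j - 1]) k)"
      by (rule sum.mono_neutral_cong_right) (auto simp: finite_Theta)
    also have "\<dots> = (\<Sum>l\<in>Theta m M. f j l (up j l))"
    proof (rule sum.reindex_bij_witness[of _ "up j" "\<lambda>k. k[j := k ! j - 1]"])
      fix l assume l: "l \<in> Theta m M"
      have u: "up j l \<in> Theta m (Suc M)" by (rule up_Theta[OF j l])
      then have *: "up j l ! j \<noteq> 0 \<and> l = (up j l)[j := up j l ! j - 1]"
        using up_eq_iff[OF j l u] by simp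
      then show "up j l \<in> {k \<in> Theta m (Suc M). k ! j \<noteq> 0}" using u by simp
      show "(up j l)[j := up j l ! j - 1] = l" using * by simp
    next
      fix k assume k: "k \<in> {k \<in> Theta m (Suc M). k ! j \<noteq> 0}"
      then show d: "k[j := k ! j - 1] \<in> Theta m M" using down_Theta[OF j] by simp
      show "up j (k[j := k ! j - 1]) = k" using up_eq_iff[OF j d] k by simp
      then show "f j (k[j := k ! j - 1]) (up j (k[j := k ! j - 1])) = f j (k[j := k ! j - 1]) k" by simp
    qed
    finally show ?thesis .
  qed
  then have "(\<Sum>j<m. \<Sum>k\<in>Theta m (Suc M). if k ! j = 0 then 0 else f j (k[j := k ! j - 1]) k)
      = (\<Sum>j<m. \<Sum>l\<in>Theta m M. f j l (up j l))" by simp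
  then show ?thesis
    by (subst (1 2) sum.swap) simp
qed

section \<open>Coefficient vectors as polynomial functions\<close>

definition mon :: "nat list \<Rightarrow> (nat \<Rightarrow> complex) \<Rightarrow> complex" where
  "mon k x = (\<Prod>j<length k. x j ^ (k ! j))"

definition poly_fun :: "nat \<Rightarrow> nat \<Rightarrow> (nat list \<Rightarrow> complex) \<Rightarrow> (nat \<Rightarrow> complex) \<Rightarrow> complex" where
  "poly_fun m N q = (\<lambda>x. \<Sum>k\<in>Theta m N. q k * mon k x)"

lemma mon_up:
  assumes "j < length k"
  shows "mon (up j k) x = x j * mon k x"
proof -
  have "mon (up j k) x = (\<Prod>i<length k. (if i = j then x j else 1) * x i ^ (k ! i))"
    unfolding mon_def up_def using assms by (auto intro!: prod.cong simp: nth_list_update)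
  also have "\<dots> = x j * mon k x"
    unfolding mon_def prod.distrib using assms by (simp add: prod.delta)
  finally show ?thesis .
qed

lemma mon_in_Pol: "k \<in> Theta m N \<Longrightarrow> mon k \<in> Pol m N"
proof (induction N arbitrary: k)
  case 0
  then have "k ! j = 0" if "j < length k" for j using that by (auto simp: Theta_def)
  then have "mon k = (\<lambda>x. 1)" by (auto simp: mon_def fun_eq_iff intro!: prod.neutral)
  then show ?case using const_in_Pol[of 1] by simp
next
  case (Suc N)
  then obtain j where j: "j < m" "k ! j \<noteq> 0"
    by (auto simp: Theta_def) (metis in_set_conv_nth not_gr_zero sum_list_eq_0_iff zero_less_Suc)
  let ?l = "k[j := k ! j - 1]"
  have l: "?l \<in> Theta m N" by (rule down_Theta[OF j(1) Suc.prems j(2)])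
  have "up j ?l = k" using up_eq_iff[OF j(1) l Suc.prems] j(2) by simp
  then have "mon k = (\<lambda>x. x j * mon ?l x)"
    using mon_up[of j ?l] j(1) l by (auto simp: Theta_def fun_eq_iff)
  then show ?case using Pol_mult_coord[OF j(1) Suc.IH[OF l]] by simp
qed

lemma linear_poly_fun: "Vector_Spaces.linear fsc fsc (poly_fun m N)"
  by (rule fsc_linearI)
     (auto simp: poly_fun_def fun_eq_iff fsc_apply distrib_right sum.distrib sum_distrib_left mult.assoc)

lemma poly_fun_in_Pol: "poly_fun m N q \<in> Pol m N"
proof -
  have "poly_fun m N q = (\<Sum>k\<in>Theta m N. fsc (q k) (mon k))"
    by (simp add: poly_fun_def fun_eq_iff sum_fun_apply fsc_apply)
  also have "\<dots> \<in> Pol m N"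
    by (intro fs.subspace_sum subspace_Pol fs.subspace_scale mon_in_Pol)
  finally show ?thesis .
qed

text \<open>Uniqueness of digits in base \<open>b\<close>: reduction modulo \<open>b\<close>
  recovers the leading list element.\<close>

lemma base_encoding_inj:
  fixes k l :: "nat list"
  assumes "length k = length l" "\<forall>a\<in>set k. a < b" "\<forall>a\<in>set l. a < b"
    "(\<Sum>j<length k. k ! j * b ^ j) = (\<Sum>j<length l. l ! j * b ^ j)"
  shows "k = l"
  using assms
proof (induction k l rule: list_induct2)
  case (Cons x k y l)
  have *: "(\<Sum>j<length (z # u). (z # u) ! j * b ^ j) = z + b * (\<Sum>j<length u. u ! j * b ^ j)"
    for z and u :: "nat list"
    unfolding length_Cons sum.lessThan_Suc_shift by (simp add: sum_distrib_left mult_ac)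
  have eq: "x + b * (\<Sum>j<length k. k ! j * b ^ j) = y + b * (\<Sum>j<length l. l ! j * b ^ j)"
    using Cons.prems(3) unfolding * .
  have "x < b" "y < b" using Cons.prems by auto
  then have "x = y" using arg_cong[OF eq, of "\<lambda>t. t mod b"] by simp
  moreover have "k = l" using Cons eq \<open>x = y\<close> \<open>x < b\<close> by auto
  ultimately show ?case by simp
qed simp

text \<open>Kronecker substitution \<open>x j = t ^ ((N + 1) ^ j)\<close> separates the monomials.\<close>

lemma poly_fun_inj:
  assumes "q \<in> supp_on (Theta m N)" "poly_fun m N q = 0"
  shows "q = 0"
proof
  let ?b = "Suc N" and ?e = "\<lambda>k. \<Sum>j<length k. k ! j * Suc N ^ j"
  have small: "\<forall>a\<in>set k. a < ?b" if "k \<in> Theta m N" for k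
    using that member_le_sum_list by (fastforce simp: Theta_def less_Suc_eq_le)
  have inj: "?e k = ?e l \<longleftrightarrow> k = l" if "k \<in> Theta m N" "l \<in> Theta m N" for k l
    using base_encoding_inj[of k l ?b] small that by (auto simp: Theta_def)
  define P where "P = (\<Sum>k\<in>Theta m N. monom (q k) (?e k))"
  have "poly P t = poly_fun m N q (\<lambda>j. t ^ (?b ^ j))" for t
    unfolding P_def poly_fun_def mon_def
    by (simp add: poly_sum poly_monom power_sum power_mult[symmetric] mult.commute)
  then have "P = 0" using assms(2) by (simp add: poly_all_0_iff_0[symmetric])
  fix l
  show "q l = 0 l"
  proof (cases "l \<in> Theta m N")
    case True
    have "coeff P (?e l) = (\<Sum>k\<in>Theta m N. if k = l then q k else 0)"
      unfolding P_def coeff_sum by (intro sum.cong) (auto simp: inj[OF _ True])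
    also have "\<dots> = q l" using True by (simp add: finite_Theta)
    finally show ?thesis using \<open>P = 0\<close> by simp
  qed (use assms(1) in \<open>simp add: supp_on_def\<close>)
qed

text \<open>Differentiation along \<open>s\<close> in terms of divided powers: no factors from the
  exponents appear, which makes it the exact transpose of \<open>mult_map\<close>.\<close>

definition deriv_map :: "nat \<Rightarrow> nat \<Rightarrow> (nat \<Rightarrow> complex) \<Rightarrow> (nat list \<Rightarrow> complex) \<Rightarrow> nat list \<Rightarrow> complex" where
  "deriv_map m M s r = (\<lambda>l. if l \<in> Theta m M then \<Sum>j<m. s j * r (up j l) else 0)"

definition mult_map :: "nat \<Rightarrow> nat \<Rightarrow> (nat \<Rightarrow> complex) \<Rightarrow> (nat list \<Rightarrow> complex) \<Rightarrow> nat list \<Rightarrow> complex" where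
  "mult_map m M s g = (\<lambda>k. if k \<in> Theta m (Suc M)
     then \<Sum>j<m. if k ! j = 0 then 0 else s j * g (k[j := k ! j - 1]) else 0)"

lemma linear_deriv_map: "Vector_Spaces.linear fsc fsc (deriv_map m M s)"
  by (rule fsc_linearI)
     (auto simp: deriv_map_def fun_eq_iff fsc_apply distrib_left sum.distrib sum_distrib_left mult.left_commute)

lemma poly_fun_mult_map: "poly_fun m (Suc M) (mult_map m M s g) = (\<lambda>x. linform m s x * poly_fun m M g x)"
proof
  fix x
  have "poly_fun m (Suc M) (mult_map m M s g) x
      = (\<Sum>k\<in>Theta m (Suc M). \<Sum>j<m. if k ! j = 0 then 0 else s j * g (k[j := k ! j - 1]) * mon k x)"
    unfolding poly_fun_def mult_map_def
    by (intro sum.cong) (auto simp: sum_distrib_right intro!: sum.cong)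
  also have "\<dots> = (\<Sum>l\<in>Theta m M. \<Sum>j<m. s j * g l * mon (up j l) x)"
    by (rule sum_Theta_shift)
  also have "\<dots> = (\<Sum>l\<in>Theta m M. linform m s x * (g l * mon l x))"
    unfolding linform_def sum_distrib_right
    by (intro sum.cong) (auto simp: mon_up Theta_def)
  also have "\<dots> = linform m s x * poly_fun m M g x"
    by (simp add: poly_fun_def sum_distrib_left)
  finally show "poly_fun m (Suc M) (mult_map m M s g) x = linform m s x * poly_fun m M g x" .
qed

lemma deriv_mult_adjoint:
  "(\<Sum>k\<in>Theta m (Suc M). r k * mult_map m M s g k) = (\<Sum>l\<in>Theta m M. deriv_map m M s r l * g l)"
proof -
  have "(\<Sum>k\<in>Theta m (Suc M). r k * mult_map m M s g k)
      = (\<Sum>k\<in>Theta m (Suc M). \<Sum>j<m. if k ! j = 0 then 0 else r k * (s j * g (k[j := k ! j - 1])))"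
    unfolding mult_map_def by (intro sum.cong) (auto simp: sum_distrib_left intro!: sum.cong)
  also have "\<dots> = (\<Sum>l\<in>Theta m M. \<Sum>j<m. r (up j l) * (s j * g l))"
    by (rule sum_Theta_shift)
  also have "\<dots> = (\<Sum>l\<in>Theta m M. deriv_map m M s r l * g l)"
    unfolding deriv_map_def by (intro sum.cong) (auto simp: sum_distrib_right intro!: sum.cong)
  finally show ?thesis .
qed

text \<open>The density theorem for colon spaces is applied to the annihilator of \<open>V\<close>,
  read as a space of forms; passing to complementary dimensions reverses the inequalities.\<close>

lemma deriv_density:
  assumes FF: "generic (Suc p) FF" and V: "fs.subspace V" "V \<subseteq> supp_on (Theta (Suc p) (Suc M))"
  shows "\<forall>\<^sub>F s in FF. fs.dim V * card (Theta (Suc p) M)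
      \<le> fs.dim (deriv_map (Suc p) M s ` V) * card (Theta (Suc p) (Suc M))"
    and "0 < fs.dim V \<Longrightarrow> fs.dim V < card (Theta (Suc p) (Suc M)) \<Longrightarrow>
      \<forall>\<^sub>F s in FF. fs.dim V * card (Theta (Suc p) M)
        < fs.dim (deriv_map (Suc p) M s ` V) * card (Theta (Suc p) (Suc M))"
proof -
  let ?m = "Suc p"
  let ?J = "Theta ?m (Suc M)" and ?J' = "Theta ?m M"
  let ?Q = "poly_fun ?m (Suc M) ` perp ?J V"
  note perp = dim_perp[OF finite_Theta V]
  have fin: "fin_dim fsc (perp ?J V)"
    by (rule fs.fin_dim_subset[OF _ supp_on_basis(3)[OF finite_Theta]]) (auto simp: perp_def)
  have dim_Q: "fs.dim ?Q = fs.dim (perp ?J V)"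
    by (rule fp.dim_image_inj_fin[OF linear_poly_fun perp(2) fin])
       (auto simp: perp_def intro: poly_fun_inj)
  have Q: "fs.subspace ?Q" "?Q \<subseteq> Pol (Suc p) (Suc M)"
    using fp.linear_subspace_image[OF linear_poly_fun perp(2)] poly_fun_in_Pol by blast+
  have le: "\<forall>\<^sub>F s in FF. fs.dim (colon ?m M s ?Q) * card ?J \<le> fs.dim ?Q * card ?J'"
    unfolding card_Theta by (rule dim_colon_le_of_strict[OF colon_density[OF FF] FF Q])
  have less: "\<forall>\<^sub>F s in FF. fs.dim (colon ?m M s ?Q) * card ?J < fs.dim ?Q * card ?J'"
    if "0 < fs.dim V" "fs.dim V < card ?J"
    unfolding card_Theta
  proof (rule colon_density[OF FF Q])
    show "0 < fs.dim ?Q" "fs.dim ?Q < (Suc M + p) choose p"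
      using perp(1) that card_Theta[of p "Suc M"] unfolding dim_Q by linarith+
  qed
  \<comment> \<open>The left side equals the product of the two cardinalities. The right side is at
    least that, because the annihilator of the image of \<open>V\<close> embeds into the colon
    space, multiplication being the transpose of differentiation.\<close>
  have dual: "fs.dim V * card ?J' + fs.dim ?Q * card ?J'
      \<le> fs.dim (deriv_map ?m M s ` V) * card ?J + fs.dim (colon ?m M s ?Q) * card ?J" for s
  proof -
    let ?U = "deriv_map ?m M s ` V"
    have U: "fs.subspace ?U" "?U \<subseteq> supp_on ?J'"
      using fp.linear_subspace_image[OF linear_deriv_map V(1)] by (auto simp: deriv_map_def supp_on_def)
    note perpU = dim_perp[OF finite_Theta U]
    have "poly_fun ?m M ` perp ?J' ?U \<subseteq> colon ?m M s ?Q"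
    proof
      fix f assume "f \<in> poly_fun ?m M ` perp ?J' ?U"
      then obtain g where g: "g \<in> perp ?J' ?U" "f = poly_fun ?m M g" by blast
      have "mult_map ?m M s g \<in> supp_on ?J" by (simp add: supp_on_def mult_map_def)
      then have "mult_map ?m M s g \<in> perp ?J V"
        using g(1) by (auto simp: perp_def deriv_mult_adjoint)
      then show "f \<in> colon ?m M s ?Q"
        using g(2) poly_fun_mult_map[of ?m M s g] poly_fun_in_Pol by (auto simp: colon_def intro!: image_eqI)
    qed
    then have "fs.dim (poly_fun ?m M ` perp ?J' ?U) \<le> fs.dim (colon ?m M s ?Q)"
      by (rule fs.dim_mono_fin[OF _ fs.fin_dim_subset[OF colon_subset fin_dim_Pol]])
    moreover have "fs.dim (poly_fun ?m M ` perp ?J' ?U) = fs.dim (perp ?J' ?U)"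
      by (rule fp.dim_image_inj_fin[OF linear_poly_fun perpU(2)
            fs.fin_dim_subset[OF _ supp_on_basis(3)[OF finite_Theta]]])
         (auto simp: perp_def intro: poly_fun_inj)
    ultimately have "fs.dim (perp ?J' ?U) * card ?J \<le> fs.dim (colon ?m M s ?Q) * card ?J" by simp
    moreover have "fs.dim (perp ?J' ?U) * card ?J + fs.dim ?U * card ?J = card ?J' * card ?J"
      using perpU(1) by (metis add_mult_distrib)
    moreover have "fs.dim ?Q * card ?J' + fs.dim V * card ?J' = card ?J' * card ?J"
      using perp(1) dim_Q by (metis add_mult_distrib mult.commute)
    ultimately show ?thesis by linarith
  qed
  show "\<forall>\<^sub>F s in FF. fs.dim V * card ?J' \<le> fs.dim (deriv_map ?m M s ` V) * card ?J"
    using le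
  proof eventually_elim
    case (elim s)
    then show ?case using dual[of s] by linarith
  qed
  show "\<forall>\<^sub>F s in FF. fs.dim V * card ?J' < fs.dim (deriv_map ?m M s ` V) * card ?J"
    if "0 < fs.dim V" "fs.dim V < card ?J"
    using less[OF that]
  proof eventually_elim
    case (elim s)
    then show ?case using dual[of s] by linarith
  qed
qed

section \<open>Specializing the map that defines F\<close>

text \<open>Linear independence makes each admissible affine form nonzero at \<open>xi\<close>.
  Applied to a finite product of such values, \<open>homs\<close> gives a specialization where none
  of them vanishes, so these conditions generate a proper filter.\<close>

lemma generic_specializations:
  assumes indep: "lin_indep_Qbar m xi" and A: "Qbar_algebra A" "\<And>j. j < m \<Longrightarrow> xi j \<in> A"
    and homs: "\<And>v. v \<in> A \<Longrightarrow> v \<noteq> 0 \<Longrightarrow> \<exists>\<phi>. Qbar_hom A \<phi> \<and> \<phi> v \<noteq> 0"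
  obtains FF where "FF \<noteq> bot" "\<forall>\<^sub>F y in FF. \<exists>\<phi>. Qbar_hom A \<phi> \<and> y = \<phi> \<circ> xi"
    "\<And>c0 c. algebraic c0 \<Longrightarrow> \<forall>j<m. algebraic (c j) \<Longrightarrow> c0 \<noteq> 0 \<or> (\<exists>j<m. c j \<noteq> 0) \<Longrightarrow>
      \<forall>\<^sub>F y in FF. c0 + linform m c y \<noteq> 0"
proof -
  define Y where "Y = {\<phi> \<circ> xi |\<phi>. Qbar_hom A \<phi>}"
  define C where "C = {(c0 :: complex, c :: nat \<Rightarrow> complex). algebraic c0 \<and> (\<forall>j<m. algebraic (c j)) \<and>
      (c0 \<noteq> 0 \<or> (\<exists>j<m. c j \<noteq> 0))}"
  define S where "S z = {y \<in> Y. fst z + linform m (snd z) y \<noteq> 0}" for z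
  define FF where "FF = (INF z\<in>C. principal (S z))"
  have lin: "fst z + linform m (snd z) xi \<in> A \<and> fst z + linform m (snd z) xi \<noteq> 0 \<and>
      (\<forall>\<phi>. Qbar_hom A \<phi> \<longrightarrow> \<phi> (fst z + linform m (snd z) xi) = fst z + linform m (snd z) (\<phi> \<circ> xi))"
    if "z \<in> C" for z
  proof -
    obtain c0 c where zc: "z = (c0, c)" by (cases z)
    then have z: "z = (c0, c)" "algebraic c0" "\<And>j. j < m \<Longrightarrow> algebraic (c j)"
        "c0 \<noteq> 0 \<or> (\<exists>j<m. c j \<noteq> 0)"
      using \<open>z \<in> C\<close> by (simp_all add: C_def)
    have cA: "c0 \<in> A" "j < m \<Longrightarrow> c j * xi j \<in> A" for j
      using z A Qbar_algebra_algebraic[OF A(1)] Qbar_algebra_mult[OF A(1)] by auto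
    then have sA: "linform m c xi \<in> A" unfolding linform_def by (intro Qbar_algebra_sum[OF A(1)]) auto
    have "c0 + linform m c xi \<noteq> 0"
      using indep z(2-4) unfolding lin_indep_Qbar_def linform_def by blast
    moreover have "\<phi> (c0 + linform m c xi) = c0 + linform m c (\<phi> \<circ> xi)" if \<phi>: "Qbar_hom A \<phi>" for \<phi>
    proof -
      have "\<phi> (linform m c xi) = (\<Sum>j<m. \<phi> (c j * xi j))"
        unfolding linform_def by (rule Qbar_hom_sum[OF A(1) \<phi>]) (use cA in auto)
      also have "\<dots> = linform m c (\<phi> \<circ> xi)"
        unfolding linform_def
        by (intro sum.cong)
           (auto simp: Qbar_hom_mult[OF A(1) \<phi>] Qbar_hom_algebraic[OF A(1) \<phi>] z A Qbar_algebra_algebraic[OF A(1)])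
      finally show ?thesis
        using Qbar_hom_add[OF A(1) \<phi> cA(1) sA] Qbar_hom_algebraic[OF A(1) \<phi> z(2)] by simp
    qed
    ultimately show ?thesis using Qbar_algebra_add[OF A(1) cA(1) sA] z(1) by simp
  qed
  show ?thesis
  proof
    show "FF \<noteq> bot"
      unfolding FF_def
    proof (rule INF_filter_not_bot)
      fix X assume X: "X \<subseteq> C" "finite X"
      let ?v = "\<Prod>z\<in>X. fst z + linform m (snd z) xi"
      have "?v \<in> A" by (rule Qbar_algebra_prod[OF A(1)]) (use lin X in blast)
      moreover have "?v \<noteq> 0" using lin X by (auto simp: prod_zero_iff)
      ultimately obtain \<phi> where \<phi>: "Qbar_hom A \<phi>" "\<phi> ?v \<noteq> 0" using homs by blast
      have "\<phi> ?v = (\<Prod>z\<in>X. \<phi> (fst z + linform m (snd z) xi))"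
        by (rule Qbar_hom_prod[OF A(1) \<phi>(1)]) (use lin X in blast)
      also have "\<dots> = (\<Prod>z\<in>X. fst z + linform m (snd z) (\<phi> \<circ> xi))"
        using lin X(1) \<phi>(1) by (intro prod.cong) auto
      finally have "\<phi> \<circ> xi \<in> (\<Inter>z\<in>X. S z)"
        using \<phi> X(2) by (auto simp: S_def Y_def)
      then show "(INF z\<in>X. principal (S z)) \<noteq> bot"
        using X(2) by (auto simp: INF_principal_finite principal_eq_bot_iff)
    qed
    have ev: "\<forall>\<^sub>F y in FF. y \<in> S z" if "z \<in> C" for z
      unfolding FF_def by (rule eventually_INF1[OF that]) (simp add: eventually_principal)
    \<comment> \<open>For this pair the hyperplane is empty, so \<open>S\<close> is all of
      \<open>Y\<close>.\<close>
    have "(1, \<lambda>_. 0) \<in> C" by (simp add: C_def algebraic_of_rat)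
    from ev[OF this] show "\<forall>\<^sub>F y in FF. \<exists>\<phi>. Qbar_hom A \<phi> \<and> y = \<phi> \<circ> xi"
      by eventually_elim (auto simp: S_def Y_def)
    show "\<forall>\<^sub>F y in FF. c0 + linform m c y \<noteq> 0"
      if "algebraic c0" "\<forall>j<m. algebraic (c j)" "c0 \<noteq> 0 \<or> (\<exists>j<m. c j \<noteq> 0)" for c0 c
    proof -
      have "(c0, c) \<in> C" using that by (simp add: C_def)
      from ev[OF this] show ?thesis by eventually_elim (simp add: S_def)
    qed
  qed
qed

section \<open>The spaces of the statement and F as a kernel\<close>

lemma scf_eq: "scf = fsc"
  by (intro ext) (simp add: scf_def fsc_def)

lemma CO_eq: "CO J = supp_on J"
  by (simp add: CO_def supp_on_def)

lemma Omega_eq: "Omega m (Suc M) = Theta m M \<union> Theta m (Suc M)"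
  by (auto simp: Omega_def Theta_def)

lemma finite_Omega: "finite (Omega m (Suc M))"
  by (simp add: Omega_eq finite_Theta)

lemma card_Omega: "card (Omega m (Suc M)) = card (Theta m M) + card (Theta m (Suc M))"
  unfolding Omega_eq by (rule card_Un_disjoint[OF finite_Theta finite_Theta]) (auto simp: Theta_def)

definition psi :: "nat \<Rightarrow> nat \<Rightarrow> (nat \<Rightarrow> complex) \<Rightarrow> (nat list \<Rightarrow> complex) \<Rightarrow> nat list \<Rightarrow> complex" where
  "psi m M y r = (\<lambda>l. if l \<in> Theta m M then r l - (\<Sum>j<m. y j * r (up j l)) else 0)"

lemma linear_psi: "Vector_Spaces.linear fsc fsc (psi m M y)"
  by (rule fsc_linearI)
     (auto simp: psi_def fun_eq_iff fsc_apply distrib_left sum.distrib sum_distrib_left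
        mult.left_commute right_diff_distrib)

lemma Z_apply: "Z m xi k x = E k x + (\<Sum>j<m. if k ! j = 0 then 0 else xi j * E (k[j := k ! j - 1]) x)"
  unfolding Z_def by (auto simp: sum_fun_apply scf_def intro!: sum.cong)

lemma Z_Theta_Suc:
  assumes "k \<in> Theta m (Suc M)" "k' \<in> Theta m (Suc M)"
  shows "Z m xi k k' = (if k' = k then 1 else 0)"
proof -
  have "k' \<noteq> k[j := k ! j - 1]" if "j < m" "k ! j \<noteq> 0" for j
    using down_Theta[OF that(1) assms(1) that(2)] assms(2) by (auto simp: Theta_def)
  then show ?thesis unfolding Z_apply by (auto simp: E_def intro!: sum.neutral)
qed

lemma psi_Z:
  assumes k: "k \<in> Theta m (Suc M)"
  shows "psi m M xi (Z m xi k) = 0"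
proof
  fix l
  show "psi m M xi (Z m xi k) l = 0 l"
  proof (cases "l \<in> Theta m M")
    case True
    have "l \<noteq> k" using True k by (auto simp: Theta_def)
    then have "Z m xi k l = (\<Sum>j<m. if up j l = k then xi j else 0)"
      unfolding Z_apply using up_eq_iff[OF _ True k] by (auto simp: E_def intro!: sum.cong)
    moreover have "(\<Sum>j<m. xi j * Z m xi k (up j l)) = (\<Sum>j<m. if up j l = k then xi j else 0)"
      using Z_Theta_Suc[OF k up_Theta[OF _ True]] by (intro sum.cong) auto
    ultimately show ?thesis by (simp add: psi_def)
  qed (simp add: psi_def)
qed

lemma Z_supp:
  assumes k: "k \<in> Theta m (Suc M)"
  shows "Z m xi k \<in> supp_on (Omega m (Suc M))"
proof -
  have "Z m xi k x = 0" if "x \<notin> Omega m (Suc M)" for x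
  proof -
    have "x \<noteq> k[j := k ! j - 1]" if "j < m" "k ! j \<noteq> 0" for j
      using down_Theta[OF that(1) k that(2)] \<open>x \<notin> Omega m (Suc M)\<close> by (auto simp: Omega_eq)
    moreover have "x \<noteq> k" using k that by (auto simp: Omega_eq)
    ultimately show ?thesis unfolding Z_apply by (auto simp: E_def intro!: sum.neutral)
  qed
  then show ?thesis by (simp add: supp_on_def)
qed

lemma psi_eq_0_imp:
  assumes "r \<in> supp_on (Omega m (Suc M))" "psi m M y r = 0" "\<And>k. k \<in> Theta m (Suc M) \<Longrightarrow> r k = 0"
  shows "r = 0"
proof
  fix l
  show "r l = 0 l"
  proof (cases "l \<in> Theta m M")
    case True
    have "r l = (\<Sum>j<m. y j * r (up j l))" using fun_cong[OF assms(2), of l] True by (simp add: psi_def)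
    also have "\<dots> = 0" using assms(3) up_Theta[OF _ True] by (auto intro!: sum.neutral)
    finally show ?thesis by simp
  qed (use assms in \<open>auto simp: supp_on_def Omega_eq\<close>)
qed

text \<open>A vector killed by \<open>psi\<close> is determined by its coordinates of degree
  \<open>Suc M\<close>, and the combination of the \<open>Z\<close> with these coordinates as
  coefficients has the same ones.\<close>

lemma F_eq_ker_psi: "F m (Suc M) xi = {r \<in> supp_on (Omega m (Suc M)). psi m M xi r = 0}"
proof
  let ?K = "{r \<in> supp_on (Omega m (Suc M)). psi m M xi r = 0}"
  have K: "fs.subspace ?K" by (rule fp.linear_subspace_ker[OF linear_psi subspace_supp_on])
  show sub: "F m (Suc M) xi \<subseteq> ?K"
    unfolding F_def scf_eq by (rule fs.span_minimal[OF _ K]) (use psi_Z Z_supp in blast)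
  show "?K \<subseteq> F m (Suc M) xi"
  proof
    fix r assume r: "r \<in> ?K"
    let ?s = "\<Sum>k\<in>Theta m (Suc M). fsc (r k) (Z m xi k)"
    have s: "?s \<in> F m (Suc M) xi"
      unfolding F_def scf_eq by (intro fs.span_sum fs.span_scale fs.span_base) auto
    then have d: "r - ?s \<in> ?K" using r sub fs.subspace_diff[OF K] by blast
    have "(r - ?s) k = 0" if "k \<in> Theta m (Suc M)" for k
    proof -
      have "?s k = (\<Sum>k'\<in>Theta m (Suc M). if k = k' then r k' else 0)"
        unfolding sum_fun_apply fsc_apply by (intro sum.cong) (auto simp: Z_Theta_Suc that)
      then show ?thesis using that by (simp add: finite_Theta)
    qed
    then have "r - ?s = 0" using psi_eq_0_imp d by blast
    then show "r \<in> F m (Suc M) xi" using s by simp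
  qed
qed

text \<open>Rank cannot grow under specialization: the relations expressing the images of
  \<open>B\<close> at \<open>xi\<close> through a basis \<open>D\<close> are carried over by
  \<open>\<phi>\<close>.\<close>

lemma dim_psi_specialize:
  assumes "finite B" "\<forall>b\<in>B. \<forall>x. algebraic (b x)"
  obtains S where "finite S"
    "\<And>A \<phi>. Qbar_algebra A \<Longrightarrow> Qbar_hom A \<phi> \<Longrightarrow> S \<subseteq> A \<Longrightarrow>
      fs.dim (psi m M (\<phi> \<circ> xi) ` fs.span B) \<le> fs.dim (psi m M xi ` fs.span B)"
proof -
  have B: "finite B" "\<And>b x. b \<in> B \<Longrightarrow> algebraic (b x)" using assms by auto
  let ?P = "psi m M xi ` B"
  have img: "psi m M y ` fs.span B = fs.span (psi m M y ` B)" for y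
    by (rule fp.linear_span_image[OF linear_psi, symmetric])
  obtain D where D: "D \<subseteq> ?P" "fs.independent D" "?P \<subseteq> fs.span D" "card D = fs.dim ?P"
    using fs.basis_exists by blast
  have finD: "finite D" using D(1) B(1) finite_subset by blast
  have "\<forall>d\<in>D. \<exists>b\<in>B. d = psi m M xi b" using D(1) by blast
  then obtain \<beta> where \<beta>: "\<And>d. d \<in> D \<Longrightarrow> \<beta> d \<in> B \<and> d = psi m M xi (\<beta> d)" by metis
  have "\<forall>b\<in>B. \<exists>u. psi m M xi b = (\<Sum>d\<in>D. fsc (u d) d)"
    using D(3) unfolding fs.span_finite[OF finD] by blast
  then obtain u where u: "\<And>b. b \<in> B \<Longrightarrow> psi m M xi b = (\<Sum>d\<in>D. fsc (u b d) d)" by metis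
  \<comment> \<open>The algebra must contain the coefficients of these relations as well as the
    coordinates of \<open>xi\<close>.\<close>
  define S where "S = xi ` {..<m} \<union> (\<lambda>(b, d). u b d) ` (B \<times> D)"
  have "finite S" unfolding S_def using B(1) finD by auto
  moreover have "fs.dim (psi m M (\<phi> \<circ> xi) ` fs.span B) \<le> fs.dim (psi m M xi ` fs.span B)"
    if A: "Qbar_algebra A" and \<phi>: "Qbar_hom A \<phi>" and SA: "S \<subseteq> A" for A \<phi>
  proof -
    note hom = Qbar_hom_diff[OF A \<phi>] Qbar_hom_sum[OF A \<phi>] Qbar_hom_mult[OF A \<phi>]
      Qbar_hom_algebraic[OF A \<phi>] Qbar_hom_0[OF A \<phi>]
    note alg = Qbar_algebra_algebraic[OF A] Qbar_algebra_mult[OF A] Qbar_algebra_sum[OF A]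
      Qbar_algebra_diff[OF A] Qbar_algebra_0[OF A]
    have xiA: "xi j \<in> A" if "j < m" for j using SA that by (auto simp: S_def)
    have uA: "u b d \<in> A" if "b \<in> B" "d \<in> D" for b d using SA that by (auto simp: S_def)
    have psi_A: "psi m M xi b l \<in> A" if "b \<in> B" for b l
      unfolding psi_def using that xiA B(2) alg(5) by (auto intro!: alg(2-4) intro: alg(1))
    have psi_hom: "\<phi> (psi m M xi b l) = psi m M (\<phi> \<circ> xi) b l" if "b \<in> B" for b l
    proof (cases "l \<in> Theta m M")
      case True
      have "\<phi> (b l - (\<Sum>j<m. xi j * b (up j l))) = \<phi> (b l) - \<phi> (\<Sum>j<m. xi j * b (up j l))"
        using that xiA B(2) by (intro hom(1) alg(2-3)) (auto intro: alg(1))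
      also have "\<phi> (\<Sum>j<m. xi j * b (up j l)) = (\<Sum>j<m. \<phi> (xi j * b (up j l)))"
        using that xiA B(2) by (intro hom(2) alg(2)) (auto intro: alg(1))
      also have "\<dots> = (\<Sum>j<m. \<phi> (xi j) * b (up j l))"
        using that xiA B(2) alg(1) by (intro sum.cong) (auto simp: hom(3,4))
      finally show ?thesis using True that B(2) by (simp add: psi_def hom(4))
    qed (simp add: psi_def hom(5))
    have "psi m M (\<phi> \<circ> xi) b = (\<Sum>d\<in>D. fsc (\<phi> (u b d)) (psi m M (\<phi> \<circ> xi) (\<beta> d)))" if b: "b \<in> B" for b
    proof
      fix l
      have dA: "d l \<in> A" if "d \<in> D" for d using \<beta>[OF that] psi_A by metis
      have "psi m M xi b l = (\<Sum>d\<in>D. u b d * d l)"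
        unfolding u[OF b] by (simp add: sum_fun_apply fsc_apply)
      then have "psi m M (\<phi> \<circ> xi) b l = \<phi> (\<Sum>d\<in>D. u b d * d l)" using psi_hom[OF b, of l] by simp
      also have "\<dots> = (\<Sum>d\<in>D. \<phi> (u b d * d l))"
        using uA[OF b] dA by (intro hom(2) alg(2)) auto
      also have "\<dots> = (\<Sum>d\<in>D. \<phi> (u b d) * psi m M (\<phi> \<circ> xi) (\<beta> d) l)"
      proof (rule sum.cong[OF refl])
        fix d assume d: "d \<in> D"
        have "\<phi> (d l) = psi m M (\<phi> \<circ> xi) (\<beta> d) l" using \<beta>[OF d] psi_hom by metis
        then show "\<phi> (u b d * d l) = \<phi> (u b d) * psi m M (\<phi> \<circ> xi) (\<beta> d) l"
          using hom(3)[OF uA[OF b d] dA[OF d]] by simp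
      qed
      finally show "psi m M (\<phi> \<circ> xi) b l = (\<Sum>d\<in>D. fsc (\<phi> (u b d)) (psi m M (\<phi> \<circ> xi) (\<beta> d))) l"
        by (simp add: sum_fun_apply fsc_apply)
    qed
    moreover have "(\<Sum>d\<in>D. fsc (\<phi> (u b d)) (psi m M (\<phi> \<circ> xi) (\<beta> d)))
        \<in> fs.span ((\<lambda>d. psi m M (\<phi> \<circ> xi) (\<beta> d)) ` D)" for b
      by (intro fs.span_sum fs.span_scale fs.span_base) auto
    ultimately have "psi m M (\<phi> \<circ> xi) ` B \<subseteq> fs.span ((\<lambda>d. psi m M (\<phi> \<circ> xi) (\<beta> d)) ` D)" by auto
    then have "psi m M (\<phi> \<circ> xi) ` fs.span B \<subseteq> fs.span ((\<lambda>d. psi m M (\<phi> \<circ> xi) (\<beta> d)) ` D)"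
      unfolding img by (rule fs.span_minimal[OF _ fs.subspace_span])
    then have "fs.dim (psi m M (\<phi> \<circ> xi) ` fs.span B) \<le> card ((\<lambda>d. psi m M (\<phi> \<circ> xi) (\<beta> d)) ` D)"
      by (rule fs.dim_le_card) (simp add: finD)
    also have "\<dots> \<le> card D" by (rule card_image_le[OF finD])
    also have "\<dots> = fs.dim (psi m M xi ` fs.span B)" unfolding img D(4) by (rule fs.dim_span[symmetric])
    finally show ?thesis .
  qed
  ultimately show ?thesis by (rule that)
qed

text \<open>A hyperplane through the origin that contains \<open>y - z\<close> is an affine
  hyperplane for \<open>y\<close>, which is why affine hyperplanes have to be avoided.\<close>

lemma generic_shift:
  assumes FF: "\<forall>\<^sub>F y in FF. \<forall>j<m. algebraic (y j)"
    and avoid: "\<And>c0 c. algebraic c0 \<Longrightarrow> \<forall>j<m. algebraic (c j) \<Longrightarrow> c0 \<noteq> 0 \<or> (\<exists>j<m. c j \<noteq> 0) \<Longrightarrow>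
      \<forall>\<^sub>F y in FF. c0 + linform m c y \<noteq> 0"
    and z: "\<And>j. j < m \<Longrightarrow> algebraic (z j)"
  shows "generic m (filtermap (\<lambda>y j. y j - z j) FF)"
  unfolding generic_def eventually_filtermap
proof (intro conjI allI impI)
  show "\<forall>\<^sub>F y in FF. \<forall>j<m. algebraic (y j - z j)"
    using FF by eventually_elim (auto intro!: algebraic_diff z)
  fix c :: "nat \<Rightarrow> complex"
  assume c: "(\<forall>j<m. algebraic (c j)) \<and> (\<exists>j<m. c j \<noteq> 0)"
  have "algebraic (linform m c z)"
    unfolding linform_def using c z by (intro algebraic_sum algebraic_add_mult(2)) auto
  then have "\<forall>\<^sub>F y in FF. - linform m c z + linform m c y \<noteq> 0"
    using c by (intro avoid algebraic_uminus) auto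
  moreover have "linform m c (\<lambda>j. y j - z j) = - linform m c z + linform m c y" for y
    by (simp add: linform_def right_diff_distrib sum_subtractf)
  ultimately show "\<forall>\<^sub>F y in FF. linform m c (\<lambda>j. y j - z j) \<noteq> 0" by simp
qed

lemma dim_F_Int:
  assumes indep: "lin_indep_Qbar (Suc p) xi"
    and R: "fs.subspace R" "R \<subseteq> supp_on (Omega (Suc p) (Suc M))"
    and B: "\<forall>b\<in>B. \<forall>x. algebraic (b x)" "fs.independent B" "fs.span B = R"
  obtains b where "fs.dim R = fs.dim (F (Suc p) (Suc M) xi \<inter> R) + b"
    "fs.dim (F (Suc p) (Suc M) xi \<inter> R) * card (Theta (Suc p) M) \<le> b * card (Theta (Suc p) (Suc M))"
    "fs.dim (F (Suc p) (Suc M) xi \<inter> R) * card (Theta (Suc p) M) = b * card (Theta (Suc p) (Suc M)) \<Longrightarrow>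
      fs.dim (F (Suc p) (Suc M) xi \<inter> R) = 0 \<or> fs.dim (F (Suc p) (Suc M) xi \<inter> R) = card (Theta (Suc p) (Suc M))"
proof -
  let ?m = "Suc p" and ?O = "Omega (Suc p) (Suc M)"
  let ?C0 = "card (Theta ?m M)" and ?C1 = "card (Theta ?m (Suc M))"
  let ?w = "fs.dim (F ?m (Suc M) xi \<inter> R)" and ?b = "fs.dim (psi ?m M xi ` R)"
  have finR: "fin_dim fsc R" by (rule fs.fin_dim_subset[OF R(2) supp_on_basis(3)[OF finite_Omega]])
  have "B \<subseteq> R" using B(3) fs.span_superset by blast
  then have finB: "finite B" using fs.fin_dim_independent_finite[OF B(2) _ finR] by blast
  have rank: "fs.dim R = fs.dim (psi ?m M y ` R) + fs.dim {r \<in> R. psi ?m M y r = 0}" for y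
    by (rule fp.rank_nullity[OF linear_psi R(1) finR])
  have "F ?m (Suc M) xi \<inter> R = {r \<in> R. psi ?m M xi r = 0}"
    using R(2) by (auto simp: F_eq_ker_psi)
  then have dimR: "fs.dim R = ?w + ?b" using rank[of xi] by simp
  obtain S where S: "finite S" "\<And>A \<phi>. Qbar_algebra A \<Longrightarrow> Qbar_hom A \<phi> \<Longrightarrow> S \<subseteq> A \<Longrightarrow>
      fs.dim (psi ?m M (\<phi> \<circ> xi) ` fs.span B) \<le> fs.dim (psi ?m M xi ` fs.span B)"
    using dim_psi_specialize[OF finB B(1), of ?m M xi] by blast
  obtain A where A: "Qbar_algebra A" "S \<union> xi ` {..<?m} \<subseteq> A"
      "\<And>v. v \<in> A \<Longrightarrow> v \<noteq> 0 \<Longrightarrow> \<exists>\<phi>. Qbar_hom A \<phi> \<and> \<phi> v \<noteq> 0"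
    using Nullstellensatz_Qbar[of "S \<union> xi ` {..<?m}"] S(1) by auto
  have xiA: "xi j \<in> A" if "j < ?m" for j using A(2) that by blast
  obtain FF where FF: "FF \<noteq> bot" "\<forall>\<^sub>F y in FF. \<exists>\<phi>. Qbar_hom A \<phi> \<and> y = \<phi> \<circ> xi"
    and avoid: "\<And>c0 c. algebraic c0 \<Longrightarrow> \<forall>j<?m. algebraic (c j) \<Longrightarrow> c0 \<noteq> 0 \<or> (\<exists>j<?m. c j \<noteq> 0) \<Longrightarrow>
      \<forall>\<^sub>F y in FF. c0 + linform ?m c y \<noteq> 0"
    using generic_specializations[OF indep A(1) xiA A(3)] by blast
  have algFF: "\<forall>\<^sub>F y in FF. \<forall>j<?m. algebraic (y j)"
    using FF(2) by eventually_elim (use xiA Qbar_hom_range[OF A(1)] in auto)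
  have le_b: "\<forall>\<^sub>F y in FF. fs.dim (psi ?m M y ` R) \<le> ?b"
    using FF(2) by eventually_elim (use S(2)[OF A(1)] A(2) B(3) in auto)
  have "\<forall>\<^sub>F y in FF. (\<forall>j<?m. algebraic (y j)) \<and> fs.dim (psi ?m M y ` R) \<le> ?b"
    using algFF le_b by (rule eventually_conj)
  then obtain z where z: "\<And>j. j < ?m \<Longrightarrow> algebraic (z j)" "fs.dim (psi ?m M z ` R) \<le> ?b"
    using eventually_happens'[OF FF(1)] by blast
  define K where "K = {r \<in> R. psi ?m M z r = 0}"
  define \<pi> where "\<pi> r = (\<lambda>k. if k \<in> Theta ?m (Suc M) then r k else 0)" for r :: "nat list \<Rightarrow> complex"
  have lin\<pi>: "Vector_Spaces.linear fsc fsc \<pi>"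
    by (rule fsc_linearI) (auto simp: \<pi>_def fun_eq_iff fsc_apply)
  have K: "fs.subspace K" "fin_dim fsc K"
    unfolding K_def using fp.linear_subspace_ker[OF linear_psi R(1)] fs.fin_dim_subset[OF _ finR] by auto
  let ?T = "\<pi> ` K"
  \<comment> \<open>On the kernel of \<open>psi\<close> at \<open>z\<close> the top degree part
    determines the vector, so \<open>\<pi>\<close> is injective there.\<close>
  have "r = 0" if "r \<in> K" "\<pi> r = 0" for r
  proof (rule psi_eq_0_imp)
    show "r \<in> supp_on ?O" "psi ?m M z r = 0" using that(1) R(2) by (auto simp: K_def)
    show "r k = 0" if "k \<in> Theta ?m (Suc M)" for k
      using fun_cong[OF \<open>\<pi> r = 0\<close>, of k] that by (simp add: \<pi>_def)
  qed
  then have "fs.dim ?T = fs.dim K" by (rule fp.dim_image_inj_fin[OF lin\<pi> K])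
  \<comment> \<open>The rank at \<open>z\<close> is at most the rank at \<open>xi\<close>, so the
    kernel at \<open>z\<close> has dimension at least \<open>w\<close>.\<close>
  then have wT: "?w \<le> fs.dim ?T" using rank[of z] dimR z(2) unfolding K_def by linarith
  have T: "fs.subspace ?T" "?T \<subseteq> supp_on (Theta ?m (Suc M))"
    using fp.linear_subspace_image[OF lin\<pi> K(1)] by (auto simp: \<pi>_def supp_on_def)
  have T_le: "fs.dim ?T \<le> ?C1"
    using fs.dim_mono_fin[OF T(2) supp_on_basis(3)[OF finite_Theta]] supp_on_basis(2)[OF finite_Theta] by metis
  let ?G = "filtermap (\<lambda>y j. y j - z j) FF"
  have gen: "generic ?m ?G" by (rule generic_shift[OF algFF avoid z(1)])
  have G: "?G \<noteq> bot" using FF(1) by (simp add: filtermap_bot_iff)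
  \<comment> \<open>If \<open>r\<close> is killed at \<open>z\<close>, then \<open>r l\<close> is
    the sum of the \<open>z j * r (up j l)\<close>; differentiating along \<open>y - z\<close>
    therefore gives minus the value of \<open>psi\<close> at \<open>y\<close>, hence the scalar
    -1.\<close>
  have sub: "deriv_map ?m M (\<lambda>j. y j - z j) ` ?T \<subseteq> psi ?m M y ` R" for y
  proof
    fix f assume "f \<in> deriv_map ?m M (\<lambda>j. y j - z j) ` ?T"
    then obtain r where r: "r \<in> R" "psi ?m M z r = 0" "f = deriv_map ?m M (\<lambda>j. y j - z j) (\<pi> r)"
      by (auto simp: K_def)
    have "f l = psi ?m M y (fsc (- 1) r) l" for l
    proof (cases "l \<in> Theta ?m M")
      case True
      have "r l = (\<Sum>j<?m. z j * r (up j l))"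
        using fun_cong[OF r(2), of l] True by (simp add: psi_def)
      moreover have "f l = (\<Sum>j<?m. (y j - z j) * r (up j l))"
        unfolding r(3) deriv_map_def \<pi>_def using True up_Theta[OF _ True] by (auto intro!: sum.cong)
      ultimately show ?thesis
        using True by (simp add: psi_def fsc_apply left_diff_distrib sum_subtractf sum_negf)
    qed (simp add: r(3) deriv_map_def psi_def)
    then show "f \<in> psi ?m M y ` R" using fs.subspace_scale[OF R(1) r(1)] by blast
  qed
  have "\<forall>\<^sub>F s in ?G. fs.dim (deriv_map ?m M s ` ?T) \<le> ?b"
    unfolding eventually_filtermap using le_b
  proof eventually_elim
    case (elim y)
    have "fs.dim (deriv_map ?m M (\<lambda>j. y j - z j) ` ?T) \<le> fs.dim (psi ?m M y ` R)"
      by (rule fs.dim_mono_fin[OF sub fp.fin_dim_image[OF linear_psi finR]])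
    then show ?case using elim by linarith
  qed
  then have U: "\<forall>\<^sub>F s in ?G. fs.dim (deriv_map ?m M s ` ?T) * ?C1 \<le> ?b * ?C1"
    by eventually_elim simp
  have le: "fs.dim ?T * ?C0 \<le> ?b * ?C1"
  proof -
    have "\<forall>\<^sub>F s in ?G. fs.dim ?T * ?C0 \<le> ?b * ?C1"
      using U deriv_density(1)[OF gen T] by eventually_elim linarith
    then show ?thesis using eventually_happens'[OF G] by blast
  qed
  have less: "fs.dim ?T * ?C0 < ?b * ?C1" if "0 < fs.dim ?T" "fs.dim ?T < ?C1"
  proof -
    have "\<forall>\<^sub>F s in ?G. fs.dim ?T * ?C0 < ?b * ?C1"
      using U deriv_density(2)[OF gen T that] by eventually_elim linarith
    then show ?thesis using eventually_happens'[OF G] by blast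
  qed
  have wT': "?w * ?C0 \<le> fs.dim ?T * ?C0" using wT by simp
  show ?thesis
  proof (rule that[OF dimR])
    show "?w * ?C0 \<le> ?b * ?C1" using wT' le by linarith
    assume eq: "?w * ?C0 = ?b * ?C1"
    \<comment> \<open>Equality holds throughout
      \<open>?w * ?C0 \<le> fs.dim ?T * ?C0 \<le> ?b * ?C1\<close>, and the strict bound excludes
      intermediate dimensions of \<open>?T\<close>.\<close>
    then have "fs.dim ?T = 0 \<or> fs.dim ?T = ?C1" using wT' less T_le by linarith
    moreover have "?w = fs.dim ?T"
    proof -
      have "?w * ?C0 = fs.dim ?T * ?C0" using eq wT' le by linarith
      moreover have "?C0 > 0" by (simp add: card_Theta)
      ultimately show ?thesis by simp
    qed
    ultimately show "?w = 0 \<or> ?w = ?C1" by simp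
  qed
qed

section \<open>Numerical form of the inequality and the case of equality\<close>

theorem theorem4:
  fixes m N :: nat and xi :: "nat \<Rightarrow> complex" and R :: "(nat list \<Rightarrow> complex) set"
  assumes "m \<ge> 1" and "N \<ge> 1"
    and "lin_indep_Qbar m xi"
    and "module.subspace scf R" and "R \<subseteq> CO (Omega m N)"
    and "defined_over_Qbar R"
  shows "real (vector_space.dim scf R)
           \<ge> (2 - (real m - 1) / (real N + real m - 1)) * real (vector_space.dim scf (F m N xi \<inter> R))
    \<and> (real (vector_space.dim scf R)
           = (2 - (real m - 1) / (real N + real m - 1)) * real (vector_space.dim scf (F m N xi \<inter> R))
       \<longleftrightarrow> R = {0} \<or> R = CO (Omega m N))"
proof -
  obtain p M where pM: "m = Suc p" "N = Suc M"
    using assms(1,2) by (metis One_nat_def Suc_le_D)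
  note [simp del] = of_nat_Suc
  define w where "w = fs.dim (F m N xi \<inter> R)"
  define C0 where "C0 = card (Theta m M)"
  define C1 where "C1 = card (Theta m N)"
  have R: "fs.subspace R" "R \<subseteq> supp_on (Omega (Suc p) (Suc M))"
    using assms(4,5) by (auto simp: scf_eq CO_eq pM)
  obtain B where B: "\<forall>b\<in>B. \<forall>x. algebraic (b x)" "fs.independent B" "fs.span B = R"
    using assms(6) unfolding defined_over_Qbar_def scf_eq by blast
  obtain b where b: "fs.dim R = w + b" "w * C0 \<le> b * C1" "w * C0 = b * C1 \<Longrightarrow> w = 0 \<or> w = C1"
    using dim_F_Int[OF assms(3)[unfolded pM] R B] unfolding w_def C0_def C1_def pM by metis
  have pos: "C0 > 0" "C1 > 0" by (simp_all add: C0_def C1_def pM card_Theta)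
  \<comment> \<open>Since \<open>p = m - 1\<close>, this identity turns the coefficient
    \<open>2 - p / (N + p)\<close> into \<open>1 + C0 / C1\<close>.\<close>
  have "C0 * (N + p) = C1 * N"
  proof -
    have "Suc M * ((Suc M + p) choose Suc M) = (Suc M + p) * ((M + p) choose M)"
      using Suc_times_binomial_eq[of "M + p" M] by (simp add: mult.commute)
    then show ?thesis
      using binomial_symmetric[of M "M + p"] binomial_symmetric[of "Suc M" "Suc M + p"]
      by (simp add: C0_def C1_def pM card_Theta mult.commute)
  qed
  then have C: "real C0 * (real N + real p) = real C1 * real N"
    by (metis of_nat_add of_nat_mult)
  have Np: "real N + real p > 0" using pM by (simp add: of_nat_Suc)
  have ratio: "2 - (real m - 1) / (real N + real m - 1) = 1 + real C0 / real C1"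
    using C Np pos by (simp add: pM(1) of_nat_Suc field_simps)
  \<comment> \<open>The defect of the claimed inequality has the sign of
    \<open>b * C1 - w * C0\<close>, which brings both claims down to natural numbers.\<close>
  have diff: "real (fs.dim R) - (1 + real C0 / real C1) * real w = (real (b * C1) - real (w * C0)) / real C1"
    using b(1) pos by (simp add: field_simps)
  have eq_iff: "real (fs.dim R) = (1 + real C0 / real C1) * real w \<longleftrightarrow> w * C0 = b * C1"
  proof -
    have "real (fs.dim R) = (1 + real C0 / real C1) * real w \<longleftrightarrow> (real (b * C1) - real (w * C0)) / real C1 = 0"
      using diff by linarith
    also have "\<dots> \<longleftrightarrow> w * C0 = b * C1" using pos by (auto simp: of_nat_eq_iff[symmetric] simp del: of_nat_mult of_nat_eq_iff)
    finally show ?thesis .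
  qed
  have ge: "real (fs.dim R) \<ge> (1 + real C0 / real C1) * real w"
  proof -
    have "(real (b * C1) - real (w * C0)) / real C1 \<ge> 0"
      using b(2) by (intro divide_nonneg_nonneg) (simp_all del: of_nat_mult)
    then show ?thesis using diff by linarith
  qed
  have O: "fs.dim (CO (Omega m N)) = C0 + C1"
    using supp_on_basis(2)[OF finite_Omega[of m M]] card_Omega[of m M]
    by (simp add: CO_eq pM C0_def C1_def)
  have finO: "fin_dim fsc (CO (Omega m N))"
    unfolding CO_eq pM by (rule supp_on_basis(3)[OF finite_Omega])
  have "w * C0 = b * C1 \<longleftrightarrow> R = {0} \<or> R = CO (Omega m N)"
  proof
    assume eq: "w * C0 = b * C1"
    from b(3)[OF eq] show "R = {0} \<or> R = CO (Omega m N)"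
    proof
      assume "w = 0"
      then have "fs.dim R = 0" using eq b(1) pos by simp
      then show ?thesis
        using fs.dim_eq_0_fin[OF R(1) fs.fin_dim_subset[OF assms(5) finO]] by blast
    next
      assume "w = C1"
      then have "fs.dim (CO (Omega m N)) \<le> fs.dim R" using eq b(1) pos O by simp
      then show ?thesis
        using fs.subspace_eq_if_dim_ge[OF R(1) _ assms(5) finO] subspace_supp_on CO_eq by metis
    qed
  next
    assume "R = {0} \<or> R = CO (Omega m N)"
    then show "w * C0 = b * C1"
    proof
      assume "R = {0}"
      then have "fs.dim R = 0" using fs.dim_zero_space by simp
      then show ?thesis using b(1) by simp
    next
      assume R': "R = CO (Omega m N)"
      \<comment> \<open>On vectors supported in degree \<open>M\<close> the map \<open>psi\<close>
        is the identity, so it is onto; for the full space this gives \<open>b = C0\<close> and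
        \<open>w = C1\<close>.\<close>
      have "psi m M xi ` R = supp_on (Theta m M)"
      proof
        show "psi m M xi ` R \<subseteq> supp_on (Theta m M)" by (auto simp: psi_def supp_on_def)
        show "supp_on (Theta m M) \<subseteq> psi m M xi ` R"
        proof
          fix f assume f: "f \<in> supp_on (Theta m M)"
          have "f (up j l) = 0" if "j < m" "l \<in> Theta m M" for j l
            using up_Theta[OF that] f by (auto simp: supp_on_def Theta_def)
          then have "psi m M xi f = f" using f by (auto simp: psi_def supp_on_def fun_eq_iff)
          moreover have "f \<in> R" using f unfolding R' CO_eq pM Omega_eq by (auto simp: supp_on_def)
          ultimately show "f \<in> psi m M xi ` R" by force
        qed
      qed
      then have "fs.dim (psi m M xi ` R) = C0"
        using supp_on_basis(2)[OF finite_Theta] by (simp add: C0_def)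
      moreover have "F m N xi \<inter> R = {r \<in> R. psi m M xi r = 0}"
        using R(2) by (auto simp: F_eq_ker_psi pM)
      ultimately have "C0 + C1 = C0 + w"
        using fp.rank_nullity[OF linear_psi R(1) fs.fin_dim_subset[OF assms(5) finO], of m M xi] O R'
        by (simp add: w_def)
      moreover have "C0 + C1 = w + b" using b(1) O R' by simp
      ultimately show ?thesis by simp
    qed
  qed
  then show ?thesis
    using ge eq_iff unfolding ratio scf_eq w_def by blast
qed

end
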